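(* Let $p\ge3$, $n\ge1$, and let $X\sim N_p(\theta,\sigma^2I_p)$ and $Z\sim N_n(0,\sigma^2I_n)$ be independent, with $\theta\in\mathbb{R}^p$, $\sigma>0$ unknown; let $S=Z'Z$, $W=\|X\|^2/S$. For real $a,b,e$ consider the generalized Bayes estimator $\delta=(1-\phi(W)/W)X$ with $$\phi(w)=w\,\frac{\int_0^1\lambda^{p/2+a+1}(1-\lambda)^b(1+w\lambda)^{-p/2-n/2-e-2}\,d\lambda}{\int_0^1\lambda^{p/2+a}(1-\lambda)^b(1+w\lambda)^{-p/2-n/2-e-2}\,d\lambda}.$$ Suppose $e>-p/2-n/2-1$, and let $c(p,n)=2(p-2)/(n+2)$ and $\alpha=(p/2+a+1)/(n/2+e-a)$. (i) If $-p/2-1<a\le\frac{c(p,n)(n/2+e)-p/2-1}{1+c(p,n)}$ and $b\ge\min(n/2+e-a-1,0)$, then $\delta$ is minimax. (ii) If $-p/2-1<a<\frac{c(p,n)(n/2+e)-p/2-1}{1+c(p,n)}$ and $$-1<-(n+2)\frac{c(p,n)-\alpha}{4(p+a+1)(\alpha+1)}\le b<\min(0,\,n/2+e-a-1),$$ then $\delta$ is minimax.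
   Context: $\delta$ is the generalized Bayes estimator $E(\eta\theta\mid X,S)/E(\eta\mid X,S)$, $\eta=1/\sigma^2$, under the hierarchical prior $\theta\mid\eta,\lambda\sim N_p(0,\eta^{-1}(1-\lambda)\lambda^{-1}I_p)$, $\eta\sim\eta^e$, $\lambda\sim\lambda^a(1-\lambda)^b$ on $(0,1)$. Minimaxity is for estimating $\theta$ under the loss $(\delta-\theta)'(\delta-\theta)/\sigma^2$; $X$ is minimax with constant risk, so $\delta$ is minimax iff its risk is at most that of $X$ for all $\theta,\sigma^2$. *)

theory Defs
  imports "HOL-Probability.Probability"
begin

definition model :: "real^'p \<Rightarrow> real \<Rightarrow> ((real^'p) \<times> (real^'n)) measure" where
  "model \<theta> \<sigma> = density lborel
     (\<lambda>(x, z). ennreal ((\<Prod>i\<in>UNIV. normal_density (\<theta> $ i) \<sigma> (x $ i)) *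
                         (\<Prod>j\<in>UNIV. normal_density 0 \<sigma> (z $ j))))"

definition risk :: "((real^'p) \<times> (real^'n) \<Rightarrow> real^'p) \<Rightarrow> real^'p \<Rightarrow> real \<Rightarrow> ennreal" where
  "risk d \<theta> \<sigma> = (\<integral>\<^sup>+ xz. ennreal ((norm (d xz - \<theta>))\<^sup>2 / \<sigma>\<^sup>2) \<partial>(model \<theta> \<sigma>))"

definition max_risk :: "((real^'p) \<times> (real^'n) \<Rightarrow> real^'p) \<Rightarrow> ennreal" where
  "max_risk d = (SUP \<theta>\<in>UNIV. SUP \<sigma>\<in>{0<..}. risk d \<theta> \<sigma>)"

definition minimax :: "((real^'p) \<times> (real^'n) \<Rightarrow> real^'p) \<Rightarrow> bool" where
  "minimax \<delta> \<longleftrightarrow> \<delta> \<in> borel_measurable borel \<and>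
     max_risk \<delta> \<le> (INF d\<in>(borel_measurable borel :: ((real^'p) \<times> (real^'n) \<Rightarrow> real^'p) set). max_risk d)"

definition phi :: "real \<Rightarrow> real \<Rightarrow> real \<Rightarrow> real \<Rightarrow> real \<Rightarrow> real \<Rightarrow> real" where
  "phi p n a b e w = w *
     (LBINT l=0..1. l powr (p/2 + a + 1) * (1 - l) powr b * (1 + w * l) powr (- p/2 - n/2 - e - 2)) /
     (LBINT l=0..1. l powr (p/2 + a) * (1 - l) powr b * (1 + w * l) powr (- p/2 - n/2 - e - 2))"

definition delta :: "real \<Rightarrow> real \<Rightarrow> real \<Rightarrow> (real^'p) \<times> (real^'n) \<Rightarrow> real^'p" where
  "delta a b e xz =
     (let x = fst xz; z = snd xz; p = real CARD('p); n = real CARD('n);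
          S = (norm z)\<^sup>2; W = (norm x)\<^sup>2 / S
      in (1 - phi p n a b e W / W) *\<^sub>R x)"

end

theory Submission
  imports Defs "HOL-Real_Asymp.Real_Asymp"
begin

text \<open>
  Write \<open>A = p/2 + a + 1\<close> and \<open>m = n/2 + e - a\<close>. Stein's identity in \<open>X\<close> and in \<open>Z\<close> bounds the risk of
  \<open>\<delta>\<close> by \<open>p\<close> as soon as \<open>(n + 2) (c - \<phi>) \<phi> + 4 (1 + \<phi>) w \<phi>' \<ge> 0\<close> for all \<open>w > 0\<close>, and \<open>p\<close> is the minimax
  value because it is the limit of the Bayes risks under normal priors with growing variance.

  Integration by parts in the defining integrals gives the Riccati equation
  \<open>w (1 + w) \<phi>' = (A - m \<phi>) (w - \<phi>) - b \<phi> (1 + \<phi>)\<close>, from which the inequality follows by barrier arguments.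
  In (i) they show \<open>\<phi> \<le> A/m \<le> c\<close> and \<open>\<phi>' \<ge> 0\<close>. In (ii) \<open>\<phi>\<close> may exceed its limit \<open>\<alpha> = A/m\<close>, but
  \<open>\<phi>/(1 + \<phi>) \<le> (\<alpha>/(1 + \<alpha>))/(1 + b)\<close> and \<open>w \<phi>'/\<phi> \<ge> b (A + 1)/(1 + b)\<close>; these two bounds combine linearly
  to the required inequality exactly under the stated lower bound on \<open>b\<close>.
\<close>

section \<open>Gaussian densities\<close>

lemma norm_sq_eq_sum_Basis: "(norm x)\<^sup>2 = (\<Sum>b\<in>Basis. (x \<bullet> b)\<^sup>2)"
  by (subst power2_norm_eq_inner, subst euclidean_inner) (simp add: power2_eq_square)

definition gauss :: "'a::euclidean_space \<Rightarrow> real \<Rightarrow> 'a \<Rightarrow> real" where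
  "gauss \<mu> \<sigma> x = (\<Prod>b\<in>Basis. normal_density (\<mu> \<bullet> b) \<sigma> (x \<bullet> b))"

lemma gauss_nonneg [simp]: "gauss \<mu> \<sigma> x \<ge> 0"
  by (simp add: gauss_def prod_nonneg)

lemma gauss_eq_exp:
  fixes \<mu> x :: "'a::euclidean_space"
  shows "gauss \<mu> \<sigma> x = (1 / sqrt (2 * pi * \<sigma>\<^sup>2)) ^ DIM('a) * exp (- (norm (x - \<mu>))\<^sup>2 / (2 * \<sigma>\<^sup>2))"
proof -
  have "gauss \<mu> \<sigma> x = (\<Prod>b\<in>(Basis :: 'a set). 1 / sqrt (2 * pi * \<sigma>\<^sup>2)) *
      (\<Prod>b\<in>Basis. exp (- ((x - \<mu>) \<bullet> b)\<^sup>2 / (2 * \<sigma>\<^sup>2)))"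
    unfolding gauss_def normal_density_def inner_diff_left by (rule prod.distrib)
  also have "(\<Prod>b\<in>Basis. exp (- ((x - \<mu>) \<bullet> b)\<^sup>2 / (2 * \<sigma>\<^sup>2))) = exp (- (norm (x - \<mu>))\<^sup>2 / (2 * \<sigma>\<^sup>2))"
    by (simp add: norm_sq_eq_sum_Basis sum_negf flip: exp_sum sum_divide_distrib)
  finally show ?thesis by simp
qed

lemma borel_measurable_gauss [measurable (raw)]:
  assumes [measurable]: "f \<in> borel_measurable M" "g \<in> borel_measurable M"
  shows "(\<lambda>y. gauss (f y) \<sigma> (g y)) \<in> borel_measurable M"
  unfolding gauss_eq_exp by measurable

lemma gauss_Pair: "gauss (\<mu>, \<nu>) \<sigma> y = gauss \<mu> \<sigma> (fst y) * gauss \<nu> \<sigma> (snd y)"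
  by (cases y)
    (simp add: gauss_eq_exp norm_Pair power_add add_divide_distrib diff_divide_distrib flip: exp_add)

lemma gauss_vec:
  fixes \<mu> x :: "real^'m"
  shows "gauss \<mu> \<sigma> x = (\<Prod>i\<in>UNIV. normal_density (\<mu> $ i) \<sigma> (x $ i))"
proof -
  have Basis_range: "(Basis :: (real^'m) set) = range (\<lambda>i. axis i 1)" by (auto simp: Basis_vec_def)
  have "inj (\<lambda>i::'m. axis i (1::real))" by (auto simp: inj_def axis_eq_axis)
  then show ?thesis unfolding gauss_def Basis_range by (simp add: prod.reindex inner_axis)
qed

lemma nn_integral_normal_density: "\<sigma> > 0 \<Longrightarrow> (\<integral>\<^sup>+t. ennreal (normal_density \<mu> \<sigma> t) \<partial>lborel) = 1"
  by (simp add: nn_integral_eq_integral)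

lemma nn_integral_normal_sq_dist:
  assumes \<sigma>: "\<sigma> > 0"
  shows "(\<integral>\<^sup>+t. ennreal (normal_density \<mu> \<sigma> t * (t - y)\<^sup>2) \<partial>lborel) = ennreal (\<sigma>\<^sup>2 + (\<mu> - y)\<^sup>2)"
proof -
  have "has_bochner_integral lborel (\<lambda>t. normal_density \<mu> \<sigma> t * (t - \<mu>)\<^sup>2 +
      2 * (\<mu> - y) * (normal_density \<mu> \<sigma> t * (t - \<mu>)) + (\<mu> - y)\<^sup>2 * normal_density \<mu> \<sigma> t)
      (\<sigma>\<^sup>2 + 2 * (\<mu> - y) * 0 + (\<mu> - y)\<^sup>2 * 1)"
    using normal_moment_even[OF \<sigma>, of \<mu> 1] normal_moment_odd[OF \<sigma>, of \<mu> 0]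
      normal_moment_even[OF \<sigma>, of \<mu> 0] \<sigma>
    by (intro has_bochner_integral_add has_bochner_integral_mult_right) (simp_all add: fact_numeral)
  then have "has_bochner_integral lborel (\<lambda>t. normal_density \<mu> \<sigma> t * (t - y)\<^sup>2) (\<sigma>\<^sup>2 + (\<mu> - y)\<^sup>2)"
    by (simp add: power2_eq_square algebra_simps)
  then show ?thesis
    by (subst nn_integral_eq_integral) (auto simp: has_bochner_integral_iff)
qed

lemma nn_integral_gauss:
  assumes "\<sigma> > 0"
  shows "(\<integral>\<^sup>+x. ennreal (gauss \<mu> \<sigma> x) \<partial>lborel) = 1"
  using assms nn_integral_lborel_prod[of "\<lambda>b t. ennreal (normal_density (\<mu> \<bullet> b) \<sigma> t)"]
  by (simp add: gauss_def nn_integral_normal_density flip: prod_ennreal)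

lemma nn_integral_gauss_coordinate_sq_dist:
  fixes \<mu> :: "'a::euclidean_space"
  assumes \<sigma>: "\<sigma> > 0" and b: "b \<in> Basis"
  shows "(\<integral>\<^sup>+x. ennreal (gauss \<mu> \<sigma> x * (x \<bullet> b - y)\<^sup>2) \<partial>lborel) = ennreal (\<sigma>\<^sup>2 + (\<mu> \<bullet> b - y)\<^sup>2)"
proof -
  let ?F = "\<lambda>u t. normal_density (\<mu> \<bullet> u) \<sigma> t * (if u = b then (t - y)\<^sup>2 else 1)"
  have "(\<integral>\<^sup>+x. ennreal (gauss \<mu> \<sigma> x * (x \<bullet> b - y)\<^sup>2) \<partial>lborel) =
      (\<integral>\<^sup>+x. (\<Prod>u\<in>Basis. ennreal (?F u (x \<bullet> u))) \<partial>lborel)"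
    using b by (simp add: gauss_def prod_ennreal prod.distrib)
  also have "\<dots> = (\<Prod>u\<in>Basis. \<integral>\<^sup>+t. ennreal (?F u t) \<partial>lborel)"
    by (rule nn_integral_lborel_prod) auto
  also have "\<dots> = (\<Prod>u\<in>Basis. if u = b then ennreal (\<sigma>\<^sup>2 + (\<mu> \<bullet> b - y)\<^sup>2) else 1)"
    by (rule prod.cong) (auto simp: nn_integral_normal_sq_dist[OF \<sigma>] nn_integral_normal_density[OF \<sigma>])
  also have "\<dots> = ennreal (\<sigma>\<^sup>2 + (\<mu> \<bullet> b - y)\<^sup>2)" using b by simp
  finally show ?thesis .
qed

lemma nn_integral_gauss_sq_dist:
  fixes \<mu> y :: "'a::euclidean_space"
  assumes "\<sigma> > 0"
  shows "(\<integral>\<^sup>+x. ennreal (gauss \<mu> \<sigma> x * (norm (x - y))\<^sup>2) \<partial>lborel) =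
    ennreal (real DIM('a) * \<sigma>\<^sup>2 + (norm (\<mu> - y))\<^sup>2)"
proof -
  have "(\<integral>\<^sup>+x. ennreal (gauss \<mu> \<sigma> x * (norm (x - y))\<^sup>2) \<partial>lborel) =
      (\<integral>\<^sup>+x. (\<Sum>b\<in>Basis. ennreal (gauss \<mu> \<sigma> x * (x \<bullet> b - y \<bullet> b)\<^sup>2)) \<partial>lborel)"
    by (simp add: norm_sq_eq_sum_Basis[of "_ - y"] inner_diff_left sum_distrib_left)
  also have "\<dots> = (\<Sum>b\<in>Basis. \<integral>\<^sup>+x. ennreal (gauss \<mu> \<sigma> x * (x \<bullet> b - y \<bullet> b)\<^sup>2) \<partial>lborel)"
    by (rule nn_integral_sum) measurable
  also have "\<dots> = ennreal (\<Sum>b\<in>Basis. \<sigma>\<^sup>2 + (\<mu> \<bullet> b - y \<bullet> b)\<^sup>2)"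
    using assms by (simp add: nn_integral_gauss_coordinate_sq_dist del: ennreal_plus)
  also have "(\<Sum>b\<in>Basis. \<sigma>\<^sup>2 + (\<mu> \<bullet> b - y \<bullet> b)\<^sup>2) = real DIM('a) * \<sigma>\<^sup>2 + (norm (\<mu> - y))\<^sup>2"
    by (simp add: norm_sq_eq_sum_Basis[of "\<mu> - y"] inner_diff_left sum.distrib)
  finally show ?thesis .
qed

lemma integrable_gauss_mult:
  fixes f :: "'a::euclidean_space \<Rightarrow> real"
  assumes \<sigma>: "\<sigma> > 0" and [measurable]: "f \<in> borel_measurable borel"
    and bound: "AE x in lborel. \<bar>f x\<bar> \<le> C * (1 + (norm (x - \<mu>))\<^sup>2)"
  shows "integrable lborel (\<lambda>x. gauss \<mu> \<sigma> x * f x)"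
proof (rule Bochner_Integration.integrable_bound)
  have "integrable lborel (gauss \<mu> \<sigma>)"
    using nn_integral_gauss[OF \<sigma>, of \<mu>] by (intro integrableI_nonneg) auto
  moreover have "integrable lborel (\<lambda>x. gauss \<mu> \<sigma> x * (norm (x - \<mu>))\<^sup>2)"
    using nn_integral_gauss_sq_dist[OF \<sigma>, of \<mu> \<mu>] by (intro integrableI_nonneg) auto
  ultimately show "integrable lborel (\<lambda>x. C * (gauss \<mu> \<sigma> x + gauss \<mu> \<sigma> x * (norm (x - \<mu>))\<^sup>2))"
    by simp
  show "AE x in lborel. norm (gauss \<mu> \<sigma> x * f x) \<le>
      norm (C * (gauss \<mu> \<sigma> x + gauss \<mu> \<sigma> x * (norm (x - \<mu>))\<^sup>2))"
    using bound
  proof eventually_elim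
    case (elim x)
    have "gauss \<mu> \<sigma> x * \<bar>f x\<bar> \<le> gauss \<mu> \<sigma> x * (C * (1 + (norm (x - \<mu>))\<^sup>2))"
      using elim by (intro mult_left_mono) auto
    then show ?case by (simp add: abs_mult algebra_simps)
  qed
qed measurable

section \<open>Stein's identity\<close>

lemma
  fixes f :: "'a::euclidean_space \<Rightarrow> real"
  assumes f: "integrable lborel f"
  shows integrable_lborel_translation: "integrable lborel (\<lambda>x. f (x + c))"
    and integral_lborel_translation: "(\<integral>x. f (x + c) \<partial>lborel) = (\<integral>x. f x \<partial>lborel)"
proof -
  have [measurable]: "f \<in> borel_measurable borel" using f by auto
  have "integrable (distr lborel borel ((+) c)) f" using f by (simp add: lborel_distr_plus)
  then show "integrable lborel (\<lambda>x. f (x + c))"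
    by (subst (asm) integrable_distr_eq) (auto simp: add.commute)
  have "(\<integral>x. f x \<partial>lborel) = (\<integral>x. f x \<partial>distr lborel borel ((+) c))" by (simp add: lborel_distr_plus)
  also have "\<dots> = (\<integral>x. f (x + c) \<partial>lborel)"
    by (subst integral_distr) (auto simp: add.commute)
  finally show "(\<integral>x. f (x + c) \<partial>lborel) = (\<integral>x. f x \<partial>lborel)" ..
qed

lemma
  fixes f :: "'a::euclidean_space \<Rightarrow> real" and v :: 'a
  assumes f: "integrable lborel f"
  shows AE_set_integrable_segment: "AE x in lborel. set_integrable lborel {0..1} (\<lambda>s. f (x + s *\<^sub>R v))"
    and borel_measurable_segment_integral:
      "(\<lambda>x. LINT s:{0..1}|lborel. f (x + s *\<^sub>R v)) \<in> borel_measurable lborel"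
    and integral_segment_integral:
      "(\<integral>x. (LINT s:{0..1}|lborel. f (x + s *\<^sub>R v)) \<partial>lborel) = (\<integral>x. f x \<partial>lborel)"
proof -
  have [measurable]: "f \<in> borel_measurable borel" using f by auto
  define F where "F s x = indicator {0..1::real} s * f (x + s *\<^sub>R v)" for s x
  have [measurable]: "case_prod F \<in> borel_measurable (lborel \<Otimes>\<^sub>M lborel)"
    unfolding F_def by measurable
  have F_integrable: "integrable (lborel \<Otimes>\<^sub>M lborel) (case_prod F)"
  proof (rule lborel_pair.Fubini_integrable)
    have "(\<integral>x. norm (case_prod F (s, x)) \<partial>lborel) = indicator {0..1} s * (\<integral>x. \<bar>f x\<bar> \<partial>lborel)" for s
      using integral_lborel_translation[of "\<lambda>x. \<bar>f x\<bar>" "s *\<^sub>R v"] f by (simp add: F_def abs_mult)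
    then show "integrable lborel (\<lambda>s. \<integral>x. norm (case_prod F (s, x)) \<partial>lborel)"
      by (simp add: integrable_real_indicator)
    show "AE s in lborel. integrable lborel (\<lambda>x. case_prod F (s, x))"
      using integrable_lborel_translation[OF f] by (simp add: F_def)
  qed measurable
  show "AE x in lborel. set_integrable lborel {0..1} (\<lambda>s. f (x + s *\<^sub>R v))"
    using lborel_pair.AE_integrable_snd[OF F_integrable] by (simp add: F_def set_integrable_def)
  have segment: "(\<integral>s. F s x \<partial>lborel) = (LINT s:{0..1}|lborel. f (x + s *\<^sub>R v))" for x
    by (simp add: F_def set_lebesgue_integral_def)
  show "(\<lambda>x. LINT s:{0..1}|lborel. f (x + s *\<^sub>R v)) \<in> borel_measurable lborel"
    using lborel_pair.integrable_snd[OF F_integrable] by (auto simp: segment)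
  have "(\<integral>x. \<integral>s. F s x \<partial>lborel \<partial>lborel) = (\<integral>s. \<integral>x. F s x \<partial>lborel \<partial>lborel)"
    using lborel_pair.Fubini_integral[OF F_integrable] .
  also have "\<dots> = (\<integral>x. f x \<partial>lborel)"
    by (simp add: F_def integral_lborel_translation[OF f])
  finally show "(\<integral>x. (LINT s:{0..1}|lborel. f (x + s *\<^sub>R v)) \<partial>lborel) = (\<integral>x. f x \<partial>lborel)"
    by (simp add: segment)
qed

text \<open>
  By translation invariance \<open>G (x + v) - G x\<close> has integral zero, and it is the integral of \<open>G'\<close> along the
  segment from \<open>x\<close> to \<open>x + v\<close>. No decay at infinity enters.
\<close>

lemma integral_directional_derivative_eq_0:
  fixes G G' :: "'a::euclidean_space \<Rightarrow> real" and v :: 'a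
  assumes G: "integrable lborel G" and G': "integrable lborel G'" and v: "v \<noteq> 0"
    and cont: "\<And>x. continuous_on UNIV (\<lambda>s::real. G (x + s *\<^sub>R v))"
    and N: "finite N" and deriv: "\<And>x. x \<notin> N \<Longrightarrow> ((\<lambda>s. G (x + s *\<^sub>R v)) has_real_derivative G' x) (at 0)"
  shows "(\<integral>x. G' x \<partial>lborel) = 0"
proof -
  have deriv_line: "((\<lambda>s. G (x + s *\<^sub>R v)) has_real_derivative G' (x + s *\<^sub>R v)) (at s)"
    if "x + s *\<^sub>R v \<notin> N" for x s
    using deriv[OF that] DERIV_shift[of "\<lambda>s. G (x + s *\<^sub>R v)" _ 0 s] by (simp add: algebra_simps)
  have finite_line: "finite {s. x + s *\<^sub>R v \<in> N}" for x
    using finite_vimageI[OF N, of "\<lambda>s. x + s *\<^sub>R v"] v by (simp add: inj_on_def vimage_def)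
  have "((\<lambda>s. G' (x + s *\<^sub>R v)) has_integral (G (x + 1 *\<^sub>R v) - G (x + 0 *\<^sub>R v))) {0..1}" for x
  proof (rule fundamental_theorem_of_calculus_interior_strong[OF finite_line[of x]])
    show "continuous_on {0..1} (\<lambda>s. G (x + s *\<^sub>R v))" using cont continuous_on_subset by blast
  qed (auto simp flip: has_real_derivative_iff_has_vector_derivative intro: deriv_line)
  then have "AE x in lborel. (LINT s:{0..1}|lborel. G' (x + s *\<^sub>R v)) = G (x + v) - G x"
    using AE_set_integrable_segment[OF G', of v]
    by (auto elim!: eventually_mono simp: set_borel_integral_eq_integral integral_unique)
  then have "(\<integral>x. (LINT s:{0..1}|lborel. G' (x + s *\<^sub>R v)) \<partial>lborel) = (\<integral>x. G (x + v) - G x \<partial>lborel)"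
    using G integrable_lborel_translation[OF G, of v]
    by (intro integral_cong_AE borel_measurable_segment_integral[OF G']) auto
  also have "\<dots> = 0"
    using G by (simp add: integral_lborel_translation[OF G] integrable_lborel_translation[OF G])
  finally show ?thesis by (simp add: integral_segment_integral[OF G'])
qed

lemma has_real_derivative_norm_sq_line:
  "((\<lambda>s. (norm (x + s *\<^sub>R v))\<^sup>2) has_real_derivative 2 * (x \<bullet> v)) (at 0)"
proof -
  have "(norm (x + s *\<^sub>R v))\<^sup>2 = x \<bullet> x + 2 * (x \<bullet> v) * s + (v \<bullet> v) * s\<^sup>2" for s
    unfolding power2_norm_eq_inner
    by (simp add: inner_add_left inner_add_right inner_commute algebra_simps power2_eq_square)
  then show ?thesis by (auto intro!: derivative_eq_intros)
qed

lemma has_real_derivative_gauss_line: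
  fixes x :: "'a::euclidean_space"
  assumes "\<sigma> > 0"
  shows "((\<lambda>s. gauss \<mu> \<sigma> (x + s *\<^sub>R v)) has_real_derivative - ((x - \<mu>) \<bullet> v) / \<sigma>\<^sup>2 * gauss \<mu> \<sigma> x) (at 0)"
proof -
  define q where "q s = (norm (x + s *\<^sub>R v - \<mu>))\<^sup>2" for s
  have q': "(q has_real_derivative 2 * ((x - \<mu>) \<bullet> v)) (at 0)"
    using has_real_derivative_norm_sq_line[of "x - \<mu>" v] by (simp add: q_def[abs_def] algebra_simps)
  have q_0: "q 0 = (norm (x - \<mu>))\<^sup>2" by (simp add: q_def)
  have gauss_q: "gauss \<mu> \<sigma> (x + s *\<^sub>R v) =
      (1 / sqrt (2 * pi * \<sigma>\<^sup>2)) ^ DIM('a) * exp (- q s / (2 * \<sigma>\<^sup>2))" for s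
    by (simp add: gauss_eq_exp q_def)
  show ?thesis
    unfolding gauss_q using assms
    by (auto intro!: derivative_eq_intros q' simp: gauss_eq_exp q_0 field_simps eval_nat_numeral)
qed

lemma stein_identity:
  fixes g g' :: "'a::euclidean_space \<Rightarrow> real"
  assumes \<sigma>: "\<sigma> > 0" and v: "v \<noteq> 0" and N: "finite N"
    and cont: "\<And>x. continuous_on UNIV (\<lambda>s::real. g (x + s *\<^sub>R v))"
    and deriv: "\<And>x. x \<notin> N \<Longrightarrow> ((\<lambda>s. g (x + s *\<^sub>R v)) has_real_derivative g' x) (at 0)"
    and integrable: "integrable lborel (\<lambda>x. gauss \<mu> \<sigma> x * g x)"
      "integrable lborel (\<lambda>x. gauss \<mu> \<sigma> x * (g' x - g x * ((x - \<mu>) \<bullet> v) / \<sigma>\<^sup>2))"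
  shows "has_bochner_integral lborel (\<lambda>x. gauss \<mu> \<sigma> x * (g' x - g x * ((x - \<mu>) \<bullet> v) / \<sigma>\<^sup>2)) 0"
proof -
  have "(\<integral>x. gauss \<mu> \<sigma> x * (g' x - g x * ((x - \<mu>) \<bullet> v) / \<sigma>\<^sup>2) \<partial>lborel) = 0"
  proof (rule integral_directional_derivative_eq_0[OF integrable v _ N])
    fix x
    show "continuous_on UNIV (\<lambda>s. gauss \<mu> \<sigma> (x + s *\<^sub>R v) * g (x + s *\<^sub>R v))"
      unfolding gauss_eq_exp using \<sigma> by (intro continuous_intros cont) simp
    assume "x \<notin> N"
    then show "((\<lambda>s. gauss \<mu> \<sigma> (x + s *\<^sub>R v) * g (x + s *\<^sub>R v)) has_real_derivative
        gauss \<mu> \<sigma> x * (g' x - g x * ((x - \<mu>) \<bullet> v) / \<sigma>\<^sup>2)) (at 0)"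
      by (auto intro!: derivative_eq_intros deriv has_real_derivative_gauss_line[OF \<sigma>]
          simp: algebra_simps diff_divide_distrib)
  qed
  with integrable(2) show ?thesis by (simp add: has_bochner_integral_iff)
qed

lemma
  fixes x \<theta> :: "'a::real_normed_vector"
  shows norm_le_one_plus_norm_diff_sq: "norm x \<le> (1 + norm \<theta>) * (1 + (norm (x - \<theta>))\<^sup>2)"
    and norm_mult_norm_diff_le: "norm x * norm (x - \<theta>) \<le> (1 + norm \<theta>) * (1 + (norm (x - \<theta>))\<^sup>2)"
proof -
  define u where "u = norm (x - \<theta>)"
  have "u \<ge> 0" by (simp add: u_def)
  then have u: "u \<ge> 0" "u \<le> 1 + u\<^sup>2"
    using sum_squares_bound[of 1 u] by auto
  have x: "norm x \<le> u + norm \<theta>"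
    unfolding u_def using norm_triangle_ineq[of "x - \<theta>" \<theta>] by simp
  have "norm x \<le> u + norm \<theta> * 1" using x by simp
  also have "\<dots> \<le> (1 + u\<^sup>2) + norm \<theta> * (1 + u\<^sup>2)"
    using u by (intro add_mono mult_left_mono) auto
  finally show "norm x \<le> (1 + norm \<theta>) * (1 + (norm (x - \<theta>))\<^sup>2)"
    by (simp add: u_def[symmetric] algebra_simps)
  have "norm x * u \<le> u\<^sup>2 + norm \<theta> * u"
    using mult_right_mono[OF x u(1)] by (simp add: power2_eq_square algebra_simps)
  also have "\<dots> \<le> (1 + u\<^sup>2) + norm \<theta> * (1 + u\<^sup>2)"
    using u by (intro add_mono mult_left_mono) auto
  finally show "norm x * norm (x - \<theta>) \<le> (1 + norm \<theta>) * (1 + (norm (x - \<theta>))\<^sup>2)"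
    by (simp add: u_def[symmetric] algebra_simps)
qed

lemma AE_fst_snd_nonzero:
  "AE y in lborel. fst y \<noteq> (0 :: 'a::euclidean_space) \<and> snd y \<noteq> (0 :: 'b::euclidean_space)"
proof -
  obtain a :: 'a and b :: 'b where "a \<in> Basis" "b \<in> Basis"
    using nonempty_Basis[where 'a = 'a] nonempty_Basis[where 'a = 'b] by blast
  then have "(a, 0) \<in> (Basis :: ('a \<times> 'b) set)" "(0, b) \<in> (Basis :: ('a \<times> 'b) set)"
    by (auto simp: Basis_prod_def)
  from this[THEN AE_lborel_inner_neq[where c = 0]] show ?thesis
    by eventually_elim auto
qed

text \<open>
  The divergence of the field \<open>h (|x|\<^sup>2) x\<close> minus its inner product with \<open>(x - \<theta>) / \<sigma>\<^sup>2\<close>.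
\<close>

definition radial_stein :: "(real \<Rightarrow> real) \<Rightarrow> (real \<Rightarrow> real) \<Rightarrow> 'a::euclidean_space \<Rightarrow> real \<Rightarrow> 'a \<Rightarrow> real" where
  "radial_stein h h' \<theta> \<sigma> x = real DIM('a) * h ((norm x)\<^sup>2) + 2 * ((norm x)\<^sup>2 * h' ((norm x)\<^sup>2))
     - h ((norm x)\<^sup>2) * (x \<bullet> (x - \<theta>)) / \<sigma>\<^sup>2"

locale radial_field =
  fixes h h' :: "real \<Rightarrow> real" and B :: real
  assumes borel_measurable [measurable]: "h \<in> borel_measurable borel" "h' \<in> borel_measurable borel"
    and deriv: "r > 0 \<Longrightarrow> (h has_real_derivative h' r) (at r)"
    and bound: "r > 0 \<Longrightarrow> \<bar>h r\<bar> \<le> B"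
    and deriv_bound: "r > 0 \<Longrightarrow> \<bar>r * h' r\<bar> \<le> B"
begin

lemma B_nonneg: "B \<ge> 0"
  using bound[of 1] by linarith

lemma continuous_on_radial_field: "continuous_on UNIV (\<lambda>x::'a::real_inner. h ((norm x)\<^sup>2) *\<^sub>R x)"
proof -
  have "isCont (\<lambda>x::'a. h ((norm x)\<^sup>2) *\<^sub>R x) x" for x
  proof (cases "x = 0")
    case True
    have "((\<lambda>x::'a. h ((norm x)\<^sup>2) *\<^sub>R x) \<longlongrightarrow> 0) (at 0)"
    proof (rule Lim_null_comparison)
      show "\<forall>\<^sub>F x in at 0. norm (h ((norm x)\<^sup>2) *\<^sub>R x) \<le> B * norm (x::'a)"
        using bound by (auto simp: eventually_at_filter intro!: mult_right_mono always_eventually)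
      show "((\<lambda>x::'a. B * norm x) \<longlongrightarrow> 0) (at 0)" by (auto intro!: tendsto_eq_intros)
    qed
    then show ?thesis by (simp add: True isCont_def)
  next
    case False
    then have "isCont h ((norm x)\<^sup>2)" using DERIV_isCont[OF deriv] by simp
    then show ?thesis by (intro continuous_intros isCont_o2[of _ "\<lambda>x. (norm x)\<^sup>2"])
  qed
  then show ?thesis by (simp add: continuous_on_eq_continuous_at)
qed

lemma has_real_derivative_radial_coordinate:
  fixes x v u :: "'a::euclidean_space"
  assumes "x \<noteq> 0"
  shows "((\<lambda>s. h ((norm (x + s *\<^sub>R v))\<^sup>2) * ((x + s *\<^sub>R v) \<bullet> u)) has_real_derivative
    h ((norm x)\<^sup>2) * (v \<bullet> u) + 2 * h' ((norm x)\<^sup>2) * ((x \<bullet> v) * (x \<bullet> u))) (at 0)"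
proof -
  have "((\<lambda>s. h ((norm (x + s *\<^sub>R v))\<^sup>2)) has_real_derivative h' ((norm x)\<^sup>2) * (2 * (x \<bullet> v))) (at 0)"
    using assms by (intro DERIV_chain2[OF _ has_real_derivative_norm_sq_line]) (auto intro: deriv)
  then show ?thesis by (auto intro!: derivative_eq_intros simp: inner_add_left)
qed

abbreviation stein_coordinate :: "'a::euclidean_space \<Rightarrow> real \<Rightarrow> 'a \<Rightarrow> 'a \<Rightarrow> real" where
  "stein_coordinate \<theta> \<sigma> b x \<equiv> h ((norm x)\<^sup>2) + 2 * h' ((norm x)\<^sup>2) * (x \<bullet> b)\<^sup>2
     - h ((norm x)\<^sup>2) * (x \<bullet> b) * ((x - \<theta>) \<bullet> b) / \<sigma>\<^sup>2"

lemma radial_stein_eq_sum: "radial_stein h h' \<theta> \<sigma> x = (\<Sum>b\<in>Basis. stein_coordinate \<theta> \<sigma> b x)"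
  unfolding radial_stein_def euclidean_inner[of x "x - \<theta>"]
  by (simp add: sum.distrib sum_subtractf mult.assoc
      flip: sum_distrib_left sum_divide_distrib norm_sq_eq_sum_Basis)

lemma abs_stein_coordinate_le:
  fixes x :: "'a::euclidean_space"
  assumes x: "x \<noteq> 0" and b: "b \<in> Basis"
  shows "\<bar>stein_coordinate \<theta> \<sigma> b x\<bar> \<le> (3 + (1 + norm \<theta>) / \<sigma>\<^sup>2) * B * (1 + (norm (x - \<theta>))\<^sup>2)"
proof -
  let ?D = "1 + (norm (x - \<theta>))\<^sup>2"
  have r: "(norm x)\<^sup>2 > 0" using x by simp
  note B = B_nonneg
  have coord: "\<bar>y \<bullet> b\<bar> \<le> norm y" for y using b by (rule Basis_le_norm)
  have "\<bar>h' ((norm x)\<^sup>2)\<bar> * (x \<bullet> b)\<^sup>2 \<le> \<bar>h' ((norm x)\<^sup>2)\<bar> * (norm x)\<^sup>2"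
    using power_mono[OF coord[of x], of 2] by (intro mult_left_mono) auto
  also have "\<dots> \<le> B" using deriv_bound[OF r] by (simp add: abs_mult mult.commute)
  finally have "\<bar>2 * h' ((norm x)\<^sup>2) * (x \<bullet> b)\<^sup>2\<bar> \<le> 2 * B" by (simp add: abs_mult)
  moreover have "\<bar>h ((norm x)\<^sup>2) * (x \<bullet> b) * ((x - \<theta>) \<bullet> b) / \<sigma>\<^sup>2\<bar> \<le> B * ((1 + norm \<theta>) * ?D) / \<sigma>\<^sup>2"
  proof -
    have "\<bar>h ((norm x)\<^sup>2) * (x \<bullet> b) * ((x - \<theta>) \<bullet> b)\<bar> \<le> B * (norm x * norm (x - \<theta>))"
      unfolding abs_mult mult.assoc using bound[OF r] B by (intro mult_mono coord) auto
    also have "\<dots> \<le> B * ((1 + norm \<theta>) * ?D)"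
      using norm_mult_norm_diff_le B by (rule mult_left_mono)
    finally show ?thesis by (simp add: divide_right_mono)
  qed
  ultimately have "\<bar>stein_coordinate \<theta> \<sigma> b x\<bar> \<le> 3 * B + B * ((1 + norm \<theta>) * ?D) / \<sigma>\<^sup>2"
    using bound[OF r] by linarith
  also have "\<dots> \<le> (3 + (1 + norm \<theta>) / \<sigma>\<^sup>2) * B * ?D"
    using B by (simp add: algebra_simps)
  finally show ?thesis .
qed

lemma abs_radial_stein_le:
  fixes x :: "'a::euclidean_space"
  assumes "x \<noteq> 0"
  shows "\<bar>radial_stein h h' \<theta> \<sigma> x\<bar> \<le>
    real DIM('a) * ((3 + (1 + norm \<theta>) / \<sigma>\<^sup>2) * B) * (1 + (norm (x - \<theta>))\<^sup>2)"
  unfolding radial_stein_eq_sum mult.assoc using abs_stein_coordinate_le[OF assms]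
  by (intro order_trans[OF sum_abs] sum_bounded_above) (simp add: mult.assoc)

lemma stein_identity_coordinate:
  fixes \<theta> :: "'a::euclidean_space"
  assumes \<sigma>: "\<sigma> > 0" and b: "b \<in> Basis"
  shows "has_bochner_integral lborel (\<lambda>x. gauss \<theta> \<sigma> x * stein_coordinate \<theta> \<sigma> b x) 0"
proof (rule stein_identity[OF \<sigma>])
  have nonzero: "AE x::'a in lborel. x \<noteq> 0" by (rule AE_lborel_singleton)
  show "integrable lborel (\<lambda>x. gauss \<theta> \<sigma> x * stein_coordinate \<theta> \<sigma> b x)"
    using nonzero
    by (intro integrable_gauss_mult[OF \<sigma>]) (auto elim!: eventually_mono dest!: abs_stein_coordinate_le[OF _ b])
  have "\<bar>h ((norm x)\<^sup>2) * (x \<bullet> b)\<bar> \<le> B * (1 + norm \<theta>) * (1 + (norm (x - \<theta>))\<^sup>2)" if "x \<noteq> 0" for x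
    unfolding abs_mult mult.assoc using b that B_nonneg
    by (intro mult_mono bound order_trans[OF Basis_le_norm norm_le_one_plus_norm_diff_sq]) auto
  then show "integrable lborel (\<lambda>x. gauss \<theta> \<sigma> x * (h ((norm x)\<^sup>2) * (x \<bullet> b)))"
    using nonzero by (intro integrable_gauss_mult[OF \<sigma>]) (auto elim!: eventually_mono)
  fix x
  have "continuous_on UNIV (\<lambda>x. (h ((norm x)\<^sup>2) *\<^sub>R x) \<bullet> b)"
    by (intro continuous_intros continuous_on_radial_field)
  then have "continuous_on UNIV (\<lambda>x. h ((norm x)\<^sup>2) * (x \<bullet> b))" by simp
  then show "continuous_on UNIV (\<lambda>s. h ((norm (x + s *\<^sub>R b))\<^sup>2) * ((x + s *\<^sub>R b) \<bullet> b))"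
    by (rule continuous_on_compose2) (auto intro!: continuous_intros)
  assume "x \<notin> {0}"
  then show "((\<lambda>s. h ((norm (x + s *\<^sub>R b))\<^sup>2) * ((x + s *\<^sub>R b) \<bullet> b)) has_real_derivative
      h ((norm x)\<^sup>2) + 2 * h' ((norm x)\<^sup>2) * (x \<bullet> b)\<^sup>2) (at 0)"
    using has_real_derivative_radial_coordinate[of x b b] b by (simp add: power2_eq_square)
qed (use b in auto)

lemma stein_identity_radial:
  assumes "\<sigma> > 0"
  shows "has_bochner_integral lborel (\<lambda>x. gauss \<theta> \<sigma> x * radial_stein h h' \<theta> \<sigma> x) 0"
  unfolding radial_stein_eq_sum sum_distrib_left
  using has_bochner_integral_sum[OF stein_identity_coordinate[OF assms]] by simp

end

lemma measurable_fst_snd_borel [measurable]: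
  "(fst :: 'a::euclidean_space \<times> 'b::euclidean_space \<Rightarrow> _) \<in> borel_measurable borel"
  "(snd :: 'a::euclidean_space \<times> 'b::euclidean_space \<Rightarrow> _) \<in> borel_measurable borel"
  by (auto intro!: borel_measurable_continuous_onI continuous_intros)

lemma has_bochner_integral_lborel_swap:
  fixes f :: "'a::euclidean_space \<times> 'b::euclidean_space \<Rightarrow> real"
  assumes "has_bochner_integral lborel f I"
  shows "has_bochner_integral lborel (\<lambda>y. f (prod.swap y)) I"
  using assms lborel_pair.integrable_product_swap_iff[of f] lborel_pair.integral_product_swap[of f]
  by (auto simp: has_bochner_integral_iff lborel_prod prod.swap_def case_prod_unfold)

lemma integrable_gauss_radial_stein_fst:
  fixes h h' :: "'b::euclidean_space \<Rightarrow> real \<Rightarrow> real" and \<theta> :: "'a::euclidean_space"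
  assumes \<sigma>: "\<sigma> > 0" and field: "\<And>z. z \<noteq> 0 \<Longrightarrow> radial_field (h z) (h' z) B"
    and meas: "(\<lambda>y. radial_stein (h (snd y)) (h' (snd y)) \<theta> \<sigma> (fst y)) \<in> borel_measurable borel"
  shows "integrable lborel
    (\<lambda>y. gauss (\<theta>, \<nu>) \<sigma> y * radial_stein (h (snd y)) (h' (snd y)) \<theta> \<sigma> (fst y))"
proof (rule integrable_gauss_mult[OF \<sigma> meas eventually_mono[OF AE_fst_snd_nonzero]])
  fix y :: "'a \<times> 'b" assume y: "fst y \<noteq> 0 \<and> snd y \<noteq> 0"
  then have "radial_field (h (snd y)) (h' (snd y)) B" by (intro field) simp
  note bound = radial_field.abs_radial_stein_le[OF this] and B = radial_field.B_nonneg[OF this]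
  let ?C = "real DIM('a) * ((3 + (1 + norm \<theta>) / \<sigma>\<^sup>2) * B)"
  have "\<bar>radial_stein (h (snd y)) (h' (snd y)) \<theta> \<sigma> (fst y)\<bar> \<le> ?C * (1 + (norm (fst y - \<theta>))\<^sup>2)"
    using bound y by blast
  also have "\<dots> \<le> ?C * (1 + (norm (y - (\<theta>, \<nu>)))\<^sup>2)"
    using B norm_fst_le[of "fst y - \<theta>" "snd y - \<nu>"]
    by (intro mult_left_mono add_left_mono power_mono) (auto simp: minus_prod_def)
  finally show "\<bar>radial_stein (h (snd y)) (h' (snd y)) \<theta> \<sigma> (fst y)\<bar> \<le>
    ?C * (1 + (norm (y - (\<theta>, \<nu>)))\<^sup>2)" .
qed

lemma stein_identity_radial_fst:
  fixes h h' :: "'b::euclidean_space \<Rightarrow> real \<Rightarrow> real" and \<theta> :: "'a::euclidean_space"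
  assumes \<sigma>: "\<sigma> > 0" and field: "\<And>z. z \<noteq> 0 \<Longrightarrow> radial_field (h z) (h' z) B"
    and meas [measurable]:
      "(\<lambda>y. radial_stein (h (snd y)) (h' (snd y)) \<theta> \<sigma> (fst y)) \<in> borel_measurable borel"
  shows "has_bochner_integral lborel
    (\<lambda>y. gauss (\<theta>, \<nu>) \<sigma> y * radial_stein (h (snd y)) (h' (snd y)) \<theta> \<sigma> (fst y)) 0"
proof -
  let ?F = "\<lambda>y. gauss (\<theta>, \<nu>) \<sigma> y * radial_stein (h (snd y)) (h' (snd y)) \<theta> \<sigma> (fst y)"
  have F: "integrable lborel ?F" by (rule integrable_gauss_radial_stein_fst[OF \<sigma> field meas])
  then have "(\<integral>y. ?F y \<partial>lborel) = (\<integral>z. \<integral>x. ?F (x, z) \<partial>lborel \<partial>lborel)"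
    using lborel_pair.integral_snd[of "\<lambda>x z. ?F (x, z)"] by (simp add: case_prod_unfold lborel_prod)
  also have "\<dots> = (\<integral>z. 0 \<partial>(lborel :: 'b measure))"
  proof (rule integral_cong_AE)
    show "AE z in lborel. (\<integral>x. ?F (x, z) \<partial>lborel) = 0"
      using AE_lborel_singleton[of 0]
    proof eventually_elim
      case (elim z)
      then have "(\<integral>x. gauss \<theta> \<sigma> x * radial_stein (h z) (h' z) \<theta> \<sigma> x \<partial>lborel) = 0"
        by (intro has_bochner_integral_integral_eq radial_field.stein_identity_radial[OF field \<sigma>])
      then have "(\<integral>x. gauss \<nu> \<sigma> z * (gauss \<theta> \<sigma> x * radial_stein (h z) (h' z) \<theta> \<sigma> x) \<partial>lborel) = 0"
        by simp
      then show ?case by (simp add: gauss_Pair mult_ac)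
    qed
  qed measurable
  finally show ?thesis using F by (simp add: has_bochner_integral_iff)
qed

lemma stein_identity_radial_snd:
  fixes h h' :: "'a::euclidean_space \<Rightarrow> real \<Rightarrow> real" and \<nu> :: "'b::euclidean_space"
  assumes "\<sigma> > 0" and "\<And>x. x \<noteq> 0 \<Longrightarrow> radial_field (h x) (h' x) B"
    and "(\<lambda>y. radial_stein (h (fst y)) (h' (fst y)) \<nu> \<sigma> (snd y)) \<in> borel_measurable borel"
  shows "has_bochner_integral lborel
    (\<lambda>y. gauss (\<theta>, \<nu>) \<sigma> y * radial_stein (h (fst y)) (h' (fst y)) \<nu> \<sigma> (snd y)) 0"
proof -
  have [measurable]: "(prod.swap :: 'b \<times> 'a \<Rightarrow> _) \<in> borel_measurable borel"
    by (auto intro!: borel_measurable_continuous_onI continuous_intros)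
  have "(\<lambda>y. radial_stein (h (snd y)) (h' (snd y)) \<nu> \<sigma> (fst y)) \<in> borel_measurable borel"
    using measurable_compose[OF _ assms(3), of prod.swap borel] by simp
  from has_bochner_integral_lborel_swap[OF stein_identity_radial_fst[OF assms(1,2) this, of \<theta>]]
  show ?thesis by (simp add: prod.swap_def case_prod_unfold gauss_Pair mult.commute)
qed

section \<open>The minimax risk\<close>

lemma model_eq_density_gauss: "model \<theta> \<sigma> = density lborel (\<lambda>y. ennreal (gauss (\<theta>, 0) \<sigma> y))"
  by (simp add: model_def gauss_Pair gauss_vec case_prod_unfold)

lemma risk_eq_nn_integral_gauss:
  assumes [measurable]: "d \<in> borel_measurable borel"
  shows "risk d \<theta> \<sigma> = (\<integral>\<^sup>+y. ennreal (gauss (\<theta>, 0) \<sigma> y * ((norm (d y - \<theta>))\<^sup>2 / \<sigma>\<^sup>2)) \<partial>lborel)"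
  unfolding risk_def model_eq_density_gauss by (simp add: nn_integral_density flip: ennreal_mult)

lemma nn_integral_lborel_pair_mult:
  fixes F :: "'a::euclidean_space \<Rightarrow> ennreal" and G :: "'b::euclidean_space \<Rightarrow> ennreal"
  assumes [measurable]: "F \<in> borel_measurable borel" "G \<in> borel_measurable borel"
  shows "(\<integral>\<^sup>+y. F (fst y) * G (snd y) \<partial>lborel) = (\<integral>\<^sup>+x. F x \<partial>lborel) * (\<integral>\<^sup>+z. G z \<partial>lborel)"
proof -
  have "(\<integral>\<^sup>+y. F (fst y) * G (snd y) \<partial>lborel) = (\<integral>\<^sup>+x. \<integral>\<^sup>+z. F x * G z \<partial>lborel \<partial>lborel)"
    unfolding lborel_prod[symmetric] by (subst lborel.nn_integral_fst[symmetric]) auto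
  also have "\<dots> = (\<integral>\<^sup>+x. F x \<partial>lborel) * (\<integral>\<^sup>+z. G z \<partial>lborel)"
    by (simp add: nn_integral_cmult nn_integral_multc)
  finally show ?thesis .
qed

lemma normal_density_conjugate:
  fixes \<nu> \<sigma> \<tau> t x :: real
  assumes \<sigma>: "\<sigma> > 0" and \<tau>: "\<tau> > 0"
  shows "normal_density \<nu> \<tau> t * normal_density t \<sigma> x =
    normal_density \<nu> (sqrt (\<sigma>\<^sup>2 + \<tau>\<^sup>2)) x *
    normal_density ((\<sigma>\<^sup>2 * \<nu> + \<tau>\<^sup>2 * x) / (\<sigma>\<^sup>2 + \<tau>\<^sup>2)) (\<sigma> * \<tau> / sqrt (\<sigma>\<^sup>2 + \<tau>\<^sup>2)) t"
proof -
  define s T where "s = \<sigma>\<^sup>2" and "T = \<tau>\<^sup>2"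
  have pos: "s > 0" "T > 0" "s + T > 0" using assms by (auto simp: s_def T_def add_pos_pos)
  have var: "(sqrt (s + T))\<^sup>2 = s + T" "(\<sigma> * \<tau> / sqrt (s + T))\<^sup>2 = s * T / (s + T)"
    using pos by (auto simp: s_def T_def power_divide power_mult_distrib)
  have "2 * pi * T * (2 * pi * s) = 2 * pi * (s + T) * (2 * pi * (s * T / (s + T)))"
    using pos by simp
  then have normalization: "1 / sqrt (2 * pi * T) * (1 / sqrt (2 * pi * s)) =
      1 / sqrt (2 * pi * (s + T)) * (1 / sqrt (2 * pi * (s * T / (s + T))))"
    by (simp only: real_sqrt_mult[symmetric] times_divide_times_eq mult_1_left)
  have mean: "t - (s * \<nu> + T * x) / (s + T) = ((s + T) * t - (s * \<nu> + T * x)) / (s + T)"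
    using pos by (simp add: field_simps)
  have exponent: "- (t - \<nu>)\<^sup>2 / (2 * T) + - (x - t)\<^sup>2 / (2 * s) =
      - (x - \<nu>)\<^sup>2 / (2 * (s + T)) + - (t - (s * \<nu> + T * x) / (s + T))\<^sup>2 / (2 * (s * T / (s + T)))"
    unfolding mean using pos
    by (simp add: power_divide divide_simps) (simp add: power2_eq_square algebra_simps)
  have combine: "u * exp e * (v * exp f) = u * v * exp (e + f)" for u v e f :: real
    by (simp add: exp_add)
  show ?thesis
    unfolding normal_density_def s_def[symmetric] T_def[symmetric] var combine exponent normalization ..
qed

lemma gauss_conjugate:
  fixes \<nu> \<theta> x :: "'a::euclidean_space"
  assumes "\<sigma> > 0" "\<tau> > 0"
  shows "gauss \<nu> \<tau> \<theta> * gauss \<theta> \<sigma> x = gauss \<nu> (sqrt (\<sigma>\<^sup>2 + \<tau>\<^sup>2)) x *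
    gauss ((\<sigma>\<^sup>2 *\<^sub>R \<nu> + \<tau>\<^sup>2 *\<^sub>R x) /\<^sub>R (\<sigma>\<^sup>2 + \<tau>\<^sup>2)) (\<sigma> * \<tau> / sqrt (\<sigma>\<^sup>2 + \<tau>\<^sup>2)) \<theta>"
  unfolding gauss_def prod.distrib[symmetric]
  by (simp add: normal_density_conjugate[OF assms] inner_add_left divide_inverse mult.commute)

lemma posterior_expected_loss_ge:
  fixes d :: "'a::euclidean_space"
  assumes \<tau>: "\<tau> > 0"
  shows "(\<integral>\<^sup>+\<theta>. ennreal (gauss 0 \<tau> \<theta> * gauss \<theta> 1 x * (norm (d - \<theta>))\<^sup>2) \<partial>lborel) \<ge>
    ennreal (gauss 0 (sqrt (1 + \<tau>\<^sup>2)) x) * ennreal (real DIM('a) * (\<tau>\<^sup>2 / (1 + \<tau>\<^sup>2)))"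
proof -
  define \<rho> where "\<rho> = sqrt (1 + \<tau>\<^sup>2)"
  have \<rho>: "\<rho> > 0" "(\<tau> / \<rho>)\<^sup>2 = \<tau>\<^sup>2 / (1 + \<tau>\<^sup>2)"
    by (simp_all add: \<rho>_def add_pos_nonneg power_divide)
  let ?\<mu> = "(\<tau>\<^sup>2 *\<^sub>R x) /\<^sub>R (1 + \<tau>\<^sup>2)"
  have "gauss 0 \<tau> \<theta> * gauss \<theta> 1 x = gauss 0 \<rho> x * gauss ?\<mu> (\<tau> / \<rho>) \<theta>" for \<theta>
    using gauss_conjugate[of 1 \<tau> 0 \<theta> x] \<tau> by (simp add: \<rho>_def)
  then have "(\<integral>\<^sup>+\<theta>. ennreal (gauss 0 \<tau> \<theta> * gauss \<theta> 1 x * (norm (d - \<theta>))\<^sup>2) \<partial>lborel) =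
      (\<integral>\<^sup>+\<theta>. ennreal (gauss 0 \<rho> x) * ennreal (gauss ?\<mu> (\<tau> / \<rho>) \<theta> * (norm (\<theta> - d))\<^sup>2) \<partial>lborel)"
    by (simp add: mult.assoc norm_minus_commute flip: ennreal_mult)
  also have "\<dots> = ennreal (gauss 0 \<rho> x) * ennreal (real DIM('a) * (\<tau> / \<rho>)\<^sup>2 + (norm (?\<mu> - d))\<^sup>2)"
    using \<tau> \<rho>(1) by (simp add: nn_integral_cmult nn_integral_gauss_sq_dist)
  also have "\<dots> \<ge> ennreal (gauss 0 \<rho> x) * ennreal (real DIM('a) * (\<tau> / \<rho>)\<^sup>2)"
    by (intro mult_left_mono ennreal_leI) auto
  finally show ?thesis unfolding \<rho>(2) by (simp add: \<rho>_def)
qed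

lemma risk_le_max_risk: "\<sigma> > 0 \<Longrightarrow> risk d \<theta> \<sigma> \<le> max_risk d"
  unfolding max_risk_def by (rule SUP_upper2[of \<theta>]) (auto intro: SUP_upper)

lemma max_risk_ge_bayes_risk:
  fixes d :: "(real^'p) \<times> (real^'n) \<Rightarrow> real^'p"
  assumes [measurable]: "d \<in> borel_measurable borel" and \<tau>: "\<tau> > 0"
  shows "ennreal (real CARD('p) * (\<tau>\<^sup>2 / (1 + \<tau>\<^sup>2))) \<le> max_risk d"
proof -
  define \<rho> where "\<rho> = sqrt (1 + \<tau>\<^sup>2)"
  let ?v = "ennreal (real CARD('p) * (\<tau>\<^sup>2 / (1 + \<tau>\<^sup>2)))"
  let ?L = "\<lambda>\<theta> y. ennreal (gauss 0 \<tau> \<theta> * gauss (\<theta>, 0) 1 y * (norm (d y - \<theta>))\<^sup>2)"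
  have \<rho>: "\<rho> > 0" by (simp add: \<rho>_def add_pos_nonneg)
  have "?v =
      (\<integral>\<^sup>+y. ennreal (gauss (0::real^'p) \<rho> (fst y)) * ennreal (gauss (0::real^'n) 1 (snd y)) \<partial>lborel) * ?v"
    by (subst nn_integral_lborel_pair_mult) (simp_all add: nn_integral_gauss \<rho>)
  also have "\<dots> =
      (\<integral>\<^sup>+y. ennreal (gauss (0::real^'n) 1 (snd y)) * (ennreal (gauss (0::real^'p) \<rho> (fst y)) * ?v) \<partial>lborel)"
    by (subst nn_integral_multc[symmetric]) (simp_all add: mult_ac)
  also have "\<dots> \<le> (\<integral>\<^sup>+y. \<integral>\<^sup>+\<theta>. ?L \<theta> y \<partial>lborel \<partial>lborel)"
  proof (rule nn_integral_mono)
    fix y :: "(real^'p) \<times> (real^'n)"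
    let ?g = "ennreal (gauss 0 1 (snd y))"
    have "?g * (ennreal (gauss 0 \<rho> (fst y)) * ?v) \<le>
        ?g * (\<integral>\<^sup>+\<theta>. ennreal (gauss 0 \<tau> \<theta> * gauss \<theta> 1 (fst y) * (norm (d y - \<theta>))\<^sup>2) \<partial>lborel)"
      using posterior_expected_loss_ge[OF \<tau>, of "fst y" "d y"]
      by (intro mult_left_mono) (auto simp: \<rho>_def)
    also have "\<dots> = (\<integral>\<^sup>+\<theta>. ?L \<theta> y \<partial>lborel)"
      by (subst nn_integral_cmult[symmetric]) (auto simp: gauss_Pair mult_ac simp flip: ennreal_mult)
    finally show "?g * (ennreal (gauss 0 \<rho> (fst y)) * ?v) \<le> (\<integral>\<^sup>+\<theta>. ?L \<theta> y \<partial>lborel)" .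
  qed
  also have "\<dots> = (\<integral>\<^sup>+\<theta>. \<integral>\<^sup>+y. ?L \<theta> y \<partial>lborel \<partial>lborel)"
    by (rule lborel_pair.Fubini') measurable
  also have "\<dots> = (\<integral>\<^sup>+\<theta>. ennreal (gauss 0 \<tau> \<theta>) * risk d \<theta> 1 \<partial>lborel)"
    by (simp add: risk_eq_nn_integral_gauss mult.assoc ennreal_mult'[of "gauss 0 \<tau> _"] nn_integral_cmult)
  also have "\<dots> \<le> (\<integral>\<^sup>+\<theta>. ennreal (gauss (0::real^'p) \<tau> \<theta>) * max_risk d \<partial>lborel)"
    by (intro nn_integral_mono mult_left_mono risk_le_max_risk) auto
  also have "\<dots> = max_risk d" by (simp add: nn_integral_multc nn_integral_gauss[OF \<tau>])
  finally show ?thesis .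
qed

lemma max_risk_ge_dimension:
  fixes d :: "(real^'p) \<times> (real^'n) \<Rightarrow> real^'p"
  assumes "d \<in> borel_measurable borel"
  shows "ennreal (real CARD('p)) \<le> max_risk d"
proof (rule tendsto_upperbound)
  have "((\<lambda>\<tau>::real. real CARD('p) * (\<tau>\<^sup>2 / (1 + \<tau>\<^sup>2))) \<longlongrightarrow> real CARD('p)) at_top"
    by real_asymp
  then show "((\<lambda>\<tau>. ennreal (real CARD('p) * (\<tau>\<^sup>2 / (1 + \<tau>\<^sup>2)))) \<longlongrightarrow> ennreal (real CARD('p))) at_top"
    by (rule tendsto_ennrealI)
  show "\<forall>\<^sub>F \<tau> in at_top. ennreal (real CARD('p) * (\<tau>\<^sup>2 / (1 + \<tau>\<^sup>2))) \<le> max_risk d"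
    using eventually_gt_at_top[of 0] by eventually_elim (rule max_risk_ge_bayes_risk[OF assms])
qed simp

lemma minimaxI:
  fixes d :: "(real^'p) \<times> (real^'n) \<Rightarrow> real^'p"
  assumes "d \<in> borel_measurable borel" and "\<And>\<theta> \<sigma>. \<sigma> > 0 \<Longrightarrow> risk d \<theta> \<sigma> \<le> ennreal (real CARD('p))"
  shows "minimax d"
  unfolding minimax_def
proof (intro conjI INF_greatest)
  fix d' :: "(real^'p) \<times> (real^'n) \<Rightarrow> real^'p" assume "d' \<in> borel_measurable borel"
  have "max_risk d \<le> ennreal (real CARD('p))"
    unfolding max_risk_def using assms(2) by (auto intro!: SUP_least)
  also have "\<dots> \<le> max_risk d'" by (rule max_risk_ge_dimension) fact
  finally show "max_risk d \<le> max_risk d'" .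
qed fact

section \<open>The risk of Baranchik estimators\<close>

lemma has_bochner_integral_gauss_fst_sq_dist:
  fixes \<theta> :: "'a::euclidean_space" and \<nu> :: "'b::euclidean_space"
  assumes \<sigma>: "\<sigma> > 0"
  shows "has_bochner_integral lborel (\<lambda>y. gauss (\<theta>, \<nu>) \<sigma> y * (norm (fst y - \<theta>))\<^sup>2) (real DIM('a) * \<sigma>\<^sup>2)"
proof (rule has_bochner_integral_nn_integral)
  have "(\<integral>\<^sup>+y. ennreal (gauss (\<theta>, \<nu>) \<sigma> y * (norm (fst y - \<theta>))\<^sup>2) \<partial>lborel) =
      (\<integral>\<^sup>+y. ennreal (gauss \<theta> \<sigma> (fst y) * (norm (fst y - \<theta>))\<^sup>2) * ennreal (gauss \<nu> \<sigma> (snd y)) \<partial>lborel)"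
    by (simp add: gauss_Pair mult_ac flip: ennreal_mult)
  also have "\<dots> = ennreal (real DIM('a) * \<sigma>\<^sup>2)"
    by (subst nn_integral_lborel_pair_mult)
      (auto simp: nn_integral_gauss[OF \<sigma>] nn_integral_gauss_sq_dist[OF \<sigma>])
  finally show "(\<integral>\<^sup>+y. ennreal (gauss (\<theta>, \<nu>) \<sigma> y * (norm (fst y - \<theta>))\<^sup>2) \<partial>lborel) =
    ennreal (real DIM('a) * \<sigma>\<^sup>2)" .
qed auto

locale baranchik =
  fixes \<phi> \<phi>' :: "real \<Rightarrow> real" and B :: real
  assumes borel_measurable [measurable]: "\<phi> \<in> borel_measurable borel" "\<phi>' \<in> borel_measurable borel"
    and deriv: "w > 0 \<Longrightarrow> (\<phi> has_real_derivative \<phi>' w) (at w)"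
    and bound: "w > 0 \<Longrightarrow> \<bar>\<phi> w\<bar> \<le> B"
    and linear_bound: "w > 0 \<Longrightarrow> \<bar>\<phi> w\<bar> \<le> B * w"
    and deriv_bound: "w > 0 \<Longrightarrow> \<bar>\<phi>' w\<bar> \<le> B"
begin

abbreviation W :: "(real^'p) \<times> (real^'n) \<Rightarrow> real" where
  "W y \<equiv> (norm (fst y))\<^sup>2 / (norm (snd y))\<^sup>2"

definition estimator :: "(real^'p) \<times> (real^'n) \<Rightarrow> real^'p" where
  "estimator y = (1 - \<phi> (W y) / W y) *\<^sub>R fst y"

definition improvement :: "real \<Rightarrow> real \<Rightarrow> real \<Rightarrow> real" where
  "improvement p n w =
     (n + 2) * (2 * (p - 2) / (n + 2) - \<phi> w) * \<phi> w + 4 * (1 + \<phi> w) * (w * \<phi>' w)"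

lemma borel_measurable_estimator [measurable]: "estimator \<in> borel_measurable borel"
  unfolding estimator_def[abs_def] by measurable

lemma quotient_bound:
  assumes "w > 0"
  shows "\<bar>\<phi> w / w\<bar> \<le> B"
  using linear_bound[OF assms] assms by (simp add: divide_le_eq abs_mult)

definition field_bound :: real where "field_bound = 2 * B + 3 * B\<^sup>2"

lemma
  assumes w: "w > 0"
  shows quotient_field_bound: "\<bar>\<phi> w / w\<bar> \<le> field_bound" "\<bar>\<phi>' w - \<phi> w / w\<bar> \<le> field_bound"
    and sq_quotient_field_bound: "\<bar>(\<phi> w)\<^sup>2 / w\<bar> \<le> field_bound"
      "\<bar>2 * \<phi> w * \<phi>' w - (\<phi> w)\<^sup>2 / w\<bar> \<le> field_bound"
proof -
  note bounds = bound[OF w] quotient_bound[OF w] deriv_bound[OF w]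
  have B: "B \<ge> 0" "B\<^sup>2 \<ge> 0" using bounds(1) by auto
  show "\<bar>\<phi> w / w\<bar> \<le> field_bound" "\<bar>\<phi>' w - \<phi> w / w\<bar> \<le> field_bound"
    unfolding field_bound_def using bounds B by linarith+
  have "\<bar>\<phi> w * (\<phi> w / w)\<bar> \<le> B\<^sup>2" "\<bar>\<phi> w * \<phi>' w\<bar> \<le> B\<^sup>2"
    unfolding abs_mult power2_eq_square using bounds B by (auto intro!: mult_mono simp del: abs_divide)
  moreover have "(\<phi> w)\<^sup>2 / w = \<phi> w * (\<phi> w / w)" by (simp add: power2_eq_square)
  ultimately show "\<bar>(\<phi> w)\<^sup>2 / w\<bar> \<le> field_bound" "\<bar>2 * \<phi> w * \<phi>' w - (\<phi> w)\<^sup>2 / w\<bar> \<le> field_bound"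
    unfolding field_bound_def mult.assoc using B by linarith+
qed

text \<open>
  Stein's identity in \<open>X\<close> for the field \<open>(\<phi> W / W) X\<close> eliminates the cross term of the loss. Since
  \<open>(\<phi> W / W)\<^sup>2 |X|\<^sup>2 = ((\<phi> W)\<^sup>2 / W) |Z|\<^sup>2\<close>, Stein's identity in \<open>Z\<close> for the field \<open>((\<phi> W)\<^sup>2 / W) Z\<close>
  eliminates the quadratic term.
\<close>

definition fst_field :: "real \<Rightarrow> real \<Rightarrow> real" where
  "fst_field S r = \<phi> (r / S) / (r / S)"

definition fst_field' :: "real \<Rightarrow> real \<Rightarrow> real" where
  "fst_field' S r = (\<phi>' (r / S) - fst_field S r) / r"

definition snd_field :: "real \<Rightarrow> real \<Rightarrow> real" where
  "snd_field R r = (\<phi> (R / r))\<^sup>2 / (R / r)"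

definition snd_field' :: "real \<Rightarrow> real \<Rightarrow> real" where
  "snd_field' R r = - (2 * \<phi> (R / r) * \<phi>' (R / r) - snd_field R r) / r"

lemmas field_defs = fst_field_def fst_field'_def snd_field_def snd_field'_def

lemma radial_field_fst:
  assumes S: "S > 0"
  shows "radial_field (fst_field S) (fst_field' S) field_bound"
proof
  fix r :: real assume r: "r > 0"
  then have w: "r / S > 0" using S by simp
  show "\<bar>fst_field S r\<bar> \<le> field_bound" "\<bar>r * fst_field' S r\<bar> \<le> field_bound"
    using quotient_field_bound[OF w] r by (simp_all add: field_defs)
  have "((\<lambda>r. \<phi> (r / S)) has_real_derivative \<phi>' (r / S) * (1 / S)) (at r)"
    using S w by (intro DERIV_chain2[of \<phi> _ "\<lambda>r. r / S"] deriv) (auto intro!: derivative_eq_intros)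
  then show "(fst_field S has_real_derivative fst_field' S r) (at r)"
    unfolding field_defs[abs_def] using r S by (auto intro!: derivative_eq_intros simp: field_simps)
qed (unfold field_defs[abs_def], measurable)

lemma radial_field_snd:
  assumes R: "R > 0"
  shows "radial_field (snd_field R) (snd_field' R) field_bound"
proof
  fix r :: real assume r: "r > 0"
  then have w: "R / r > 0" using R by simp
  show "\<bar>snd_field R r\<bar> \<le> field_bound" "\<bar>r * snd_field' R r\<bar> \<le> field_bound"
    using sq_quotient_field_bound[OF w] r by (simp_all add: field_defs abs_minus_commute)
  have "((\<lambda>r. \<phi> (R / r)) has_real_derivative \<phi>' (R / r) * (- R / r\<^sup>2)) (at r)"
    using r w by (intro DERIV_chain2[of \<phi> _ "\<lambda>r. R / r"] deriv)
      (auto intro!: derivative_eq_intros simp: power2_eq_square)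
  then show "(snd_field R has_real_derivative snd_field' R r) (at r)"
    unfolding field_defs[abs_def] using r R
    by (auto intro!: derivative_eq_intros simp: field_simps power2_eq_square)
qed (unfold field_defs[abs_def], measurable)

definition stein_fst :: "real^'p \<Rightarrow> real \<Rightarrow> (real^'p) \<times> (real^'n) \<Rightarrow> real" where
  "stein_fst \<theta> \<sigma> y =
     radial_stein (fst_field ((norm (snd y))\<^sup>2)) (fst_field' ((norm (snd y))\<^sup>2)) \<theta> \<sigma> (fst y)"

definition stein_snd :: "real \<Rightarrow> (real^'p) \<times> (real^'n) \<Rightarrow> real" where
  "stein_snd \<sigma> y =
     radial_stein (snd_field ((norm (fst y))\<^sup>2)) (snd_field' ((norm (fst y))\<^sup>2)) 0 \<sigma> (snd y)"

lemma has_bochner_integral_stein: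
  assumes "\<sigma> > 0"
  shows "has_bochner_integral lborel (\<lambda>y. gauss (\<theta>, 0) \<sigma> y * stein_fst \<theta> \<sigma> y) 0"
    and "has_bochner_integral lborel (\<lambda>y. gauss (\<theta>, 0) \<sigma> y * stein_snd \<sigma> y) 0"
  unfolding stein_fst_def stein_snd_def
  by (rule stein_identity_radial_fst[OF assms radial_field_fst], simp, simp add: radial_stein_def field_defs)
    (rule stein_identity_radial_snd[OF assms radial_field_snd], simp, simp add: radial_stein_def field_defs)

lemma improvement_eq:
  assumes "w > 0" and "n \<ge> 0"
  shows "improvement p n w / w = 2 * p * (\<phi> w / w) + 4 * (\<phi>' w - \<phi> w / w)
    - n * ((\<phi> w)\<^sup>2 / w) + 2 * (2 * \<phi> w * \<phi>' w - (\<phi> w)\<^sup>2 / w)"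
proof -
  have "(n + 2) * (2 * (p - 2) / (n + 2)) = 2 * (p - 2)" using assms(2) by simp
  then have expand: "improvement p n w = 2 * (p - 2) * \<phi> w - (n + 2) * (\<phi> w)\<^sup>2 + 4 * (1 + \<phi> w) * (w * \<phi>' w)"
    by (simp only: improvement_def right_diff_distrib left_diff_distrib power2_eq_square
        mult.assoc[symmetric])
  show ?thesis unfolding expand using assms(1) by (simp add: field_simps power2_eq_square)
qed

lemma loss_estimator:
  fixes y :: "(real^'p) \<times> (real^'n)"
  assumes "fst y \<noteq> 0" "snd y \<noteq> 0"
  shows "(norm (estimator y - \<theta>))\<^sup>2 / \<sigma>\<^sup>2 =
    (norm (fst y - \<theta>))\<^sup>2 / \<sigma>\<^sup>2 + 2 * stein_fst \<theta> \<sigma> y - stein_snd \<sigma> y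
    - improvement (real CARD('p)) (real CARD('n)) (W y) / W y"
proof -
  define x z w where "x = fst y" and "z = snd y" and "w = W y"
  have pos: "(norm x)\<^sup>2 > 0" "(norm z)\<^sup>2 > 0" "w > 0" using assms by (auto simp: x_def z_def w_def)
  have x_sq: "(norm x)\<^sup>2 = w * (norm z)\<^sup>2" using pos by (simp add: w_def x_def z_def)
  define h k where "h = \<phi> w / w" and "k = (\<phi> w)\<^sup>2 / w"
  have error: "estimator y - \<theta> = (x - \<theta>) - h *\<^sub>R x"
    by (simp add: estimator_def h_def w_def x_def algebra_simps)
  have "(norm (estimator y - \<theta>))\<^sup>2 = (norm (x - \<theta>))\<^sup>2 - 2 * h * (x \<bullet> (x - \<theta>)) + h\<^sup>2 * (norm x)\<^sup>2"
    unfolding error power2_norm_eq_inner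
    by (simp add: inner_diff_left inner_diff_right inner_commute power2_eq_square algebra_simps)
  also have "h\<^sup>2 * (norm x)\<^sup>2 = k * (norm z)\<^sup>2"
    using pos unfolding x_sq by (simp add: h_def k_def power2_eq_square)
  finally have "(norm (estimator y - \<theta>))\<^sup>2 / \<sigma>\<^sup>2 =
      (norm (x - \<theta>))\<^sup>2 / \<sigma>\<^sup>2 - 2 * (h * (x \<bullet> (x - \<theta>)) / \<sigma>\<^sup>2) + k * (norm z)\<^sup>2 / \<sigma>\<^sup>2"
    by (simp add: add_divide_distrib diff_divide_distrib)
  moreover have "stein_fst \<theta> \<sigma> y = real CARD('p) * h + 2 * (\<phi>' w - h) - h * (x \<bullet> (x - \<theta>)) / \<sigma>\<^sup>2"
    using pos by (simp add: stein_fst_def radial_stein_def field_defs h_def w_def flip: x_def z_def)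
  moreover have "stein_snd \<sigma> y = real CARD('n) * k - 2 * (2 * \<phi> w * \<phi>' w - k) - k * (norm z)\<^sup>2 / \<sigma>\<^sup>2"
    using pos
    by (simp add: stein_snd_def radial_stein_def field_defs k_def w_def power2_norm_eq_inner
        flip: x_def z_def)
  moreover note improvement_eq[OF pos(3), of "real CARD('n)" "real CARD('p)", folded h_def k_def]
  ultimately show ?thesis
    unfolding w_def[symmetric] unfolding x_def[symmetric] z_def[symmetric] by simp
qed

lemma risk_estimator_le_dimension:
  fixes \<theta> :: "real^'p"
  assumes \<sigma>: "\<sigma> > 0" and nonneg: "\<And>w. w > 0 \<Longrightarrow> improvement (real CARD('p)) (real CARD('n)) w \<ge> 0"
  shows "risk (estimator :: (real^'p) \<times> (real^'n) \<Rightarrow> real^'p) \<theta> \<sigma> \<le> ennreal (real CARD('p))"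
proof -
  let ?f = "gauss (\<theta>, 0) \<sigma> :: (real^'p) \<times> (real^'n) \<Rightarrow> real"
  define R where "R y = ?f y * (norm (fst y - \<theta>))\<^sup>2 / \<sigma>\<^sup>2
    + 2 * (?f y * stein_fst \<theta> \<sigma> y) - ?f y * stein_snd \<sigma> y" for y
  have "has_bochner_integral lborel R (real CARD('p) * \<sigma>\<^sup>2 / \<sigma>\<^sup>2 + 2 * 0 - 0)"
    unfolding R_def[abs_def] using has_bochner_integral_gauss_fst_sq_dist[OF \<sigma>, of \<theta> 0] \<sigma>
    by (intro has_bochner_integral_add has_bochner_integral_diff has_bochner_integral_mult_right
        has_bochner_integral_divide has_bochner_integral_stein) auto
  then have R: "has_bochner_integral lborel R (real CARD('p))" using \<sigma> by simp
  have loss_le: "AE y in lborel. ?f y * ((norm (estimator y - \<theta>))\<^sup>2 / \<sigma>\<^sup>2) \<le> R y"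
    using AE_fst_snd_nonzero
  proof eventually_elim
    case (elim y)
    then have "improvement (real CARD('p)) (real CARD('n)) (W y) / W y \<ge> 0"
      by (intro divide_nonneg_pos nonneg) auto
    then have "?f y * ((norm (estimator y - \<theta>))\<^sup>2 / \<sigma>\<^sup>2) \<le>
        ?f y * ((norm (fst y - \<theta>))\<^sup>2 / \<sigma>\<^sup>2 + 2 * stein_fst \<theta> \<sigma> y - stein_snd \<sigma> y)"
      using elim by (intro mult_left_mono) (auto simp: loss_estimator)
    then show ?case by (simp add: R_def algebra_simps)
  qed
  have nonneg_R: "AE y in lborel. 0 \<le> R y"
    using loss_le by eventually_elim (rule order_trans[rotated], auto)
  have "risk (estimator :: (real^'p) \<times> (real^'n) \<Rightarrow> real^'p) \<theta> \<sigma> =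
      (\<integral>\<^sup>+y. ennreal (?f y * ((norm (estimator y - \<theta>))\<^sup>2 / \<sigma>\<^sup>2)) \<partial>lborel)"
    by (rule risk_eq_nn_integral_gauss) measurable
  also have "\<dots> \<le> (\<integral>\<^sup>+y. ennreal (R y) \<partial>lborel)"
    using loss_le by (intro nn_integral_mono_AE) (auto elim!: eventually_mono intro: ennreal_leI)
  also have "\<dots> = ennreal (real CARD('p))"
    using R nonneg_R by (subst nn_integral_eq_integral) (auto simp: has_bochner_integral_iff)
  finally show ?thesis .
qed

lemma minimax_estimator:
  assumes "\<And>w. w > 0 \<Longrightarrow> improvement (real CARD('p)) (real CARD('n)) w \<ge> 0"
  shows "minimax (estimator :: (real^'p) \<times> (real^'n) \<Rightarrow> real^'p)"
  using assms by (intro minimaxI risk_estimator_le_dimension) measurable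

end

section \<open>Moments of a beta weight\<close>

lemma has_real_derivative_lebesgue_integral:
  fixes f f' :: "real \<Rightarrow> 'a \<Rightarrow> real"
  assumes S: "open S" "convex S" "w \<in> S"
    and integrable: "\<And>y. y \<in> S \<Longrightarrow> integrable M (f y)"
    and deriv: "AE x in M. \<forall>y\<in>S. ((\<lambda>y. f y x) has_real_derivative f' y x) (at y)"
    and bound: "AE x in M. \<forall>y\<in>S. \<bar>f' y x\<bar> \<le> K x" and K: "integrable M K"
    and meas: "f' w \<in> borel_measurable M"
  shows "((\<lambda>y. \<integral>x. f y x \<partial>M) has_real_derivative (\<integral>x. f' w x \<partial>M)) (at w)"
proof -
  let ?q = "\<lambda>y x. (f y x - f w x) / (y - w)"
  have "(\<lambda>n. \<integral>x. ?q (Y n) x \<partial>M) \<longlonglongrightarrow> (\<integral>x. f' w x \<partial>M)"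
    if Y: "\<And>n. Y n \<in> S - {w}" "Y \<longlonglongrightarrow> w" for Y
  proof (rule integral_dominated_convergence[OF meas _ K])
    show "?q (Y n) \<in> borel_measurable M" for n
      using Y(1)[of n] integrable[of "Y n"] integrable[OF S(3)] by auto
    have "filterlim Y (at w) sequentially" using Y by (auto simp: filterlim_at)
    then show "AE x in M. (\<lambda>n. ?q (Y n) x) \<longlonglongrightarrow> f' w x"
      using deriv S(3)
      by (auto elim!: eventually_mono simp: has_field_derivative_iff intro: filterlim_compose)
    show "AE x in M. norm (?q (Y n) x) \<le> K x" for n
      using deriv bound
    proof eventually_elim
      case (elim x)
      have "norm (f (Y n) x - f w x) \<le> K x * norm (Y n - w)"
        using Y(1)[of n] S elim
        by (intro field_differentiable_bound[where f = "\<lambda>y. f y x" and f' = "\<lambda>y. f' y x", OF S(2)])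
          (auto intro: has_field_derivative_at_within)
      then show ?case using Y(1)[of n] by (simp add: divide_le_eq)
    qed
  qed
  then have "((\<lambda>y. ((\<integral>x. f y x \<partial>M) - (\<integral>x. f w x \<partial>M)) / (y - w)) \<longlongrightarrow> (\<integral>x. f' w x \<partial>M)) (at w within S)"
    using integrable S(3) by (subst tendsto_at_iff_sequentially) (simp add: o_def)
  then show ?thesis
    using S at_within_open[OF S(3,1)] by (simp add: has_field_derivative_iff)
qed

lemma powr_minus_le_1:
  fixes w l r :: real
  assumes "w \<ge> 0" "l \<ge> 0" "r \<ge> 0"
  shows "(1 + w * l) powr (- r) \<le> 1"
  using assms by (simp add: powr_minus inverse_le_1_iff ge_one_powr_ge_zero)

lemma has_real_derivative_powr_kernel:
  fixes w l r :: real
  assumes "w * l > -1"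
  shows "((\<lambda>w. (1 + w * l) powr (- r)) has_real_derivative - r * l * (1 + w * l) powr (- (r + 1))) (at w)"
    and "((\<lambda>l. (1 + w * l) powr (- r)) has_real_derivative - r * w * (1 + w * l) powr (- (r + 1))) (at l)"
proof -
  have exponent: "- (r + 1) = - r - 1" by simp
  have powr: "((\<lambda>u. u powr (- r)) has_real_derivative - r * (1 + w * l) powr (- (r + 1))) (at (1 + w * l))"
    unfolding exponent using assms by (intro has_real_derivative_powr) simp
  show "((\<lambda>w. (1 + w * l) powr (- r)) has_real_derivative - r * l * (1 + w * l) powr (- (r + 1))) (at w)"
    by (rule DERIV_cong[OF DERIV_chain2[where g = "\<lambda>w. 1 + w * l", OF powr]])
      (auto intro!: derivative_eq_intros)
  show "((\<lambda>l. (1 + w * l) powr (- r)) has_real_derivative - r * w * (1 + w * l) powr (- (r + 1))) (at l)"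
    by (rule DERIV_cong[OF DERIV_chain2[where g = "\<lambda>l. 1 + w * l", OF powr]])
      (auto intro!: derivative_eq_intros)
qed

locale beta_weight =
  fixes A b :: real
  assumes A_pos: "A > 0" and b_gt: "b > -1"
begin

definition beta_measure :: "real measure" where
  "beta_measure = density lborel (\<lambda>l. ennreal (indicator {0<..<1} l * (l powr (A - 1) * (1 - l) powr b)))"

definition mom :: "nat \<Rightarrow> real \<Rightarrow> real \<Rightarrow> real" where
  "mom i r w = (\<integral>l. l ^ i * (1 + w * l) powr (- r) \<partial>beta_measure)"

lemma sets_beta_measure [measurable_cong, simp]: "sets beta_measure = sets borel"
  and space_beta_measure [simp]: "space beta_measure = UNIV"
  by (simp_all add: beta_measure_def)

lemma integrable_beta_weight:
  "integrable lborel (\<lambda>l::real. indicator {0<..<1} l * (l powr (A - 1) * (1 - l) powr b))"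
proof -
  have "set_integrable lborel {0..1} (\<lambda>l::real. l powr (A - 1) * (1 - l) powr (b + 1 - 1))"
    by (rule integrable_Beta) (use A_pos b_gt in auto)
  then have "set_integrable lborel {0<..<1} (\<lambda>l::real. l powr (A - 1) * (1 - l) powr b)"
    by (auto intro: set_integrable_subset)
  then show ?thesis by (simp add: set_integrable_def)
qed

lemma emeasure_beta_measure:
  "emeasure beta_measure UNIV =
    (\<integral>\<^sup>+l. ennreal (indicator {0<..<1} l * (l powr (A - 1) * (1 - l) powr b)) \<partial>lborel)"
  by (simp add: beta_measure_def emeasure_density)

lemma finite_measure_beta: "finite_measure beta_measure"
proof
  show "emeasure beta_measure (space beta_measure) \<noteq> \<infinity>"
    using integrable_beta_weight
    by (simp add: emeasure_beta_measure) (subst nn_integral_eq_integral, auto simp: indicator_def)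
qed

sublocale finite_measure beta_measure by (rule finite_measure_beta)

lemma AE_beta_measure: "AE l in beta_measure. 0 < l \<and> l < 1"
  unfolding beta_measure_def by (subst AE_density) (auto simp: indicator_def)

lemma emeasure_beta_measure_nonzero: "emeasure beta_measure UNIV \<noteq> 0"
proof
  assume "emeasure beta_measure UNIV = 0"
  then have "AE l in lborel. l \<notin> {0<..<1::real}"
    unfolding emeasure_beta_measure
    by (subst (asm) nn_integral_0_iff_AE)
      (auto simp: indicator_def elim!: eventually_mono split: if_splits)
  then have "emeasure lborel {0<..<1::real} = 0"
    by (subst (asm) AE_iff_null_sets[symmetric]) auto
  then show False by simp
qed

lemma integral_beta_measure:
  assumes [measurable]: "f \<in> borel_measurable borel"
  shows "(\<integral>l. f l \<partial>beta_measure) = (LBINT l=0..1. l powr (A - 1) * (1 - l) powr b * f l)"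
proof -
  have "(\<integral>l. f l \<partial>beta_measure) =
      (\<integral>l. indicator {0<..<1} l * (l powr (A - 1) * (1 - l) powr b) * f l \<partial>lborel)"
    unfolding beta_measure_def by (subst integral_density) (auto simp: indicator_def)
  also have "\<dots> = (LBINT l=ereal 0..ereal 1. l powr (A - 1) * (1 - l) powr b * f l)"
    by (simp add: interval_lebesgue_integral_def set_lebesgue_integral_def einterval_eq mult.assoc)
  finally show ?thesis by (simp add: zero_ereal_def one_ereal_def)
qed

lemma integrable_beta_measure:
  fixes B :: real
  assumes "f \<in> borel_measurable borel" and "\<And>l. 0 < l \<Longrightarrow> l < 1 \<Longrightarrow> \<bar>f l\<bar> \<le> B"
  shows "integrable beta_measure f"
  using AE_beta_measure assms by (intro integrable_const_bound[where B = B]) auto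

lemma integrable_mom:
  assumes "w \<ge> 0" "r \<ge> 0"
  shows "integrable beta_measure (\<lambda>l. l ^ i * (1 + w * l) powr (- r))"
  using assms powr_minus_le_1
  by (intro integrable_beta_measure[where B = 1]) (auto simp: abs_mult power_le_one intro!: mult_le_one)

lemma borel_measurable_mom [measurable]: "mom i r \<in> borel_measurable borel"
  unfolding mom_def[abs_def] by measurable

lemma mom_pos:
  assumes "w \<ge> 0" "r \<ge> 0"
  shows "mom i r w > 0"
proof -
  have "(\<integral>l. 0 \<partial>beta_measure) < mom i r w"
    unfolding mom_def
  proof (rule integral_less_AE_space)
    show "AE l in beta_measure. 0 < l ^ i * (1 + w * l) powr (- r)"
      using AE_beta_measure
    proof eventually_elim
      case (elim l)
      then have "1 + w * l > 0" using assms by (simp add: add_pos_nonneg)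
      with elim show ?case by simp
    qed
  qed (use assms emeasure_beta_measure_nonzero in \<open>auto intro: integrable_mom\<close>)
  then show ?thesis by simp
qed

lemma mom_Suc_less:
  assumes "w \<ge> 0" "r \<ge> 0"
  shows "mom (Suc i) r w < mom i r w"
  unfolding mom_def
proof (rule integral_less_AE_space)
  show "AE l in beta_measure. l ^ Suc i * (1 + w * l) powr (- r) < l ^ i * (1 + w * l) powr (- r)"
    using AE_beta_measure
  proof eventually_elim
    case (elim l)
    then have "1 + w * l > 0" using assms by (simp add: add_pos_nonneg)
    with elim show ?case by (intro mult_strict_right_mono power_strict_decreasing) auto
  qed
qed (use assms emeasure_beta_measure_nonzero in \<open>auto intro: integrable_mom simp del: power_Suc\<close>)

lemma mom_shift:
  assumes "w \<ge> 0" "r \<ge> 0"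
  shows "mom i r w = mom i (r + 1) w + w * mom (Suc i) (r + 1) w"
proof -
  have "mom i r w =
      (\<integral>l. l ^ i * (1 + w * l) powr (- (r + 1)) + w * (l ^ Suc i * (1 + w * l) powr (- (r + 1))) \<partial>beta_measure)"
    unfolding mom_def
  proof (rule integral_cong_AE)
    show "AE l in beta_measure. l ^ i * (1 + w * l) powr - r =
        l ^ i * (1 + w * l) powr - (r + 1) + w * (l ^ Suc i * (1 + w * l) powr - (r + 1))"
      using AE_beta_measure
    proof eventually_elim
      case (elim l)
      then have "1 + w * l > 0" using assms by (simp add: add_pos_nonneg)
      then have "(1 + w * l) powr - r = (1 + w * l) * (1 + w * l) powr - (r + 1)"
        using powr_add[of "1 + w * l" 1 "- (r + 1)"] by simp
      then show ?case by (simp only:) (simp add: algebra_simps)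
    qed
  qed measurable
  also have "\<dots> = mom i (r + 1) w + w * mom (Suc i) (r + 1) w"
    unfolding mom_def using assms integrable_mom[of w "r + 1"]
    by (subst Bochner_Integration.integral_add) (auto simp del: power_Suc)
  finally show ?thesis .
qed

lemma has_real_derivative_mom:
  assumes w: "w > 0" and r: "r \<ge> 0"
  shows "(mom i r has_real_derivative - r * mom (Suc i) (r + 1) w) (at w)"
proof -
  let ?f' = "\<lambda>y l. - r * (l ^ Suc i * (1 + y * l) powr (- (r + 1)))"
  have "((\<lambda>y. \<integral>l. l ^ i * (1 + y * l) powr (- r) \<partial>beta_measure) has_real_derivative
      (\<integral>l. ?f' w l \<partial>beta_measure)) (at w)"
  proof (rule has_real_derivative_lebesgue_integral[where S = "{0<..}" and f' = ?f' and K = "\<lambda>_. r"])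
    show "AE l in beta_measure. \<forall>y\<in>{0<..}.
        ((\<lambda>y. l ^ i * (1 + y * l) powr (- r)) has_real_derivative ?f' y l) (at y)"
      using AE_beta_measure
    proof eventually_elim
      case (elim l)
      have "y * l > -1" if "y > 0" for y
        using mult_pos_pos[OF that, of l] elim by linarith
      then show ?case
        by (auto intro!: DERIV_cong[OF DERIV_cmult[OF has_real_derivative_powr_kernel(1)]] simp: mult_ac)
    qed
    show "AE l in beta_measure. \<forall>y\<in>{0<..}. \<bar>?f' y l\<bar> \<le> r"
      using AE_beta_measure
    proof eventually_elim
      case (elim l)
      have "l ^ Suc i * (1 + y * l) powr (- (r + 1)) \<le> 1" if "y > 0" for y
        using that elim r by (intro mult_le_one powr_minus_le_1 power_le_one) auto
      then show ?case using elim r by (auto simp: abs_mult mult_left_le simp del: power_Suc)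
    qed
  qed (use w r in \<open>auto intro: integrable_mom\<close>)
  then show ?thesis by (simp add: mom_def[abs_def] del: power_Suc)
qed

lemma integrable_beta_measure_continuous:
  fixes f :: "real \<Rightarrow> real"
  assumes "continuous_on {0..1} f" and "f \<in> borel_measurable borel"
  shows "integrable beta_measure f"
proof -
  have "compact (f ` {0..1})" using assms(1) by (intro compact_continuous_image) simp_all
  then obtain K where "\<And>l. l \<in> {0..1} \<Longrightarrow> \<bar>f l\<bar> \<le> K"
    by (metis (no_types, lifting) bounded_iff compact_imp_bounded image_eqI real_norm_def)
  with assms(2) show ?thesis by (intro integrable_beta_measure[where B = K]) auto
qed

lemma
  fixes f :: "real \<Rightarrow> real"
  assumes "continuous_on {0..1} f"
  shows tendsto_beta_weight_at_right_0: "((\<lambda>l. l powr A * (1 - l) powr (b + 1) * f l) \<longlongrightarrow> 0) (at_right 0)"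
    and tendsto_beta_weight_at_left_1: "((\<lambda>l. l powr A * (1 - l) powr (b + 1) * f l) \<longlongrightarrow> 0) (at_left 1)"
proof -
  have "((\<lambda>l. l powr A * (1 - l) powr (b + 1) * f l) \<longlongrightarrow> 0 powr A * (1 - 0) powr (b + 1) * f 0) (at_right 0)"
    using A_pos continuous_on_Icc_at_rightD[OF assms]
    by (intro tendsto_mult tendsto_powr' tendsto_intros)
      (auto simp: eventually_at_right_less intro: eventually_mono[OF eventually_at_right_less])
  then show "((\<lambda>l. l powr A * (1 - l) powr (b + 1) * f l) \<longlongrightarrow> 0) (at_right 0)" using A_pos by simp
  have "((\<lambda>l. l powr A * (1 - l) powr (b + 1) * f l) \<longlongrightarrow> 1 powr A * (1 - 1) powr (b + 1) * f 1) (at_left 1)"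
    using b_gt continuous_on_Icc_at_leftD[OF assms]
    by (intro tendsto_mult tendsto_powr' tendsto_intros)
      (auto intro!: eventually_mono[OF eventually_at_left_real[of 0 1]])
  then show "((\<lambda>l. l powr A * (1 - l) powr (b + 1) * f l) \<longlongrightarrow> 0) (at_left 1)" using b_gt by simp
qed

lemma integral_beta_by_parts:
  fixes f f' :: "real \<Rightarrow> real"
  assumes cont: "continuous_on {0..1} f" "continuous_on {0..1} f'"
    and deriv: "\<And>l. 0 < l \<Longrightarrow> l < 1 \<Longrightarrow> (f has_real_derivative f' l) (at l)"
    and meas [measurable]: "f \<in> borel_measurable borel" "f' \<in> borel_measurable borel"
  shows "(\<integral>l. (A * (1 - l) - (b + 1) * l) * f l + l * (1 - l) * f' l \<partial>beta_measure) = 0"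
proof -
  let ?g = "\<lambda>l. (A * (1 - l) - (b + 1) * l) * f l + l * (1 - l) * f' l"
  let ?F = "\<lambda>l. l powr A * (1 - l) powr (b + 1) * f l"
  let ?F' = "\<lambda>l. l powr (A - 1) * (1 - l) powr b * ?g l"
  have "(LBINT l=ereal 0..ereal 1. ?F' l) = 0 - 0"
  proof (rule interval_integral_FTC_integrable[where F = ?F])
    fix l assume "ereal 0 < ereal l" "ereal l < ereal 1"
    then have l: "0 < l" "l < 1" by auto
    have "l powr A = l powr (A - 1) * l" "(1 - l) powr (b + 1) = (1 - l) powr b * (1 - l)"
      using l powr_add[of l "A - 1" 1] powr_add[of "1 - l" b 1] by simp_all
    then have "(?F has_real_derivative ?F' l) (at l)"
      using l by (auto intro!: derivative_eq_intros deriv) (simp add: algebra_simps)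
    then show "(?F has_vector_derivative ?F' l) (at l)"
      by (simp add: has_real_derivative_iff_has_vector_derivative)
    have "isCont f l" "isCont f' l"
      using cont[THEN continuous_on_interior] l by auto
    then show "isCont ?F' l" using l by (intro continuous_intros) auto
  next
    have "integrable beta_measure ?g"
      by (intro integrable_beta_measure_continuous continuous_intros cont) measurable
    then show "set_integrable lborel (einterval (ereal 0) (ereal 1)) ?F'"
      unfolding beta_measure_def
      by (subst (asm) integrable_density) (auto simp: set_integrable_def mult.assoc indicator_def)
  qed (simp_all add: ereal_tendsto_simps tendsto_beta_weight_at_right_0 tendsto_beta_weight_at_left_1 cont)
  then show ?thesis
    by (subst integral_beta_measure) (auto simp: zero_ereal_def one_ereal_def)
qed

lemma mom_by_parts:
  assumes w: "w > 0" and r: "r \<ge> 0"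
  shows "A * mom 0 r w - (A + b + 1) * mom 1 r w = r * w * (mom 1 (r + 1) w - mom 2 (r + 1) w)"
proof -
  let ?f = "\<lambda>l. (1 + w * l) powr (- r)" and ?f' = "\<lambda>l. - r * w * (1 + w * l) powr (- (r + 1))"
  have pos: "1 + w * l > 0" if "l \<ge> 0" for l using w that by (simp add: add_pos_nonneg)
  have mom: "has_bochner_integral beta_measure (\<lambda>l. l ^ i * (1 + w * l) powr (- q)) (mom i q w)"
    if "q \<ge> 0" for i q
    unfolding mom_def using w that by (intro has_bochner_integral_integrable integrable_mom) auto
  have "0 = (\<integral>l. (A * (1 - l) - (b + 1) * l) * ?f l + l * (1 - l) * ?f' l \<partial>beta_measure)"
  proof (rule integral_beta_by_parts[symmetric])
    show "continuous_on {0..1} ?f" "continuous_on {0..1} ?f'"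
      by (intro continuous_intros; use pos in force)+
    show "(?f has_real_derivative ?f' l) (at l)" if "0 < l" "l < 1" for l
      using that pos[of l] by (intro has_real_derivative_powr_kernel) simp
  qed measurable
  also have "\<dots> = (\<integral>l. A * (l ^ 0 * ?f l) - (A + b + 1) * (l ^ 1 * ?f l)
      - r * w * (l ^ 1 * (1 + w * l) powr (- (r + 1)) - l ^ 2 * (1 + w * l) powr (- (r + 1))) \<partial>beta_measure)"
    by (intro Bochner_Integration.integral_cong) (auto simp: algebra_simps power2_eq_square)
  also have "\<dots> = A * mom 0 r w - (A + b + 1) * mom 1 r w - r * w * (mom 1 (r + 1) w - mom 2 (r + 1) w)"
    using r
    by (intro has_bochner_integral_integral_eq has_bochner_integral_diff has_bochner_integral_mult_right mom)
      auto
  finally show ?thesis by simp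
qed

end

definition riccati :: "real \<Rightarrow> real \<Rightarrow> real \<Rightarrow> real \<Rightarrow> real \<Rightarrow> real" where
  "riccati A b m w y = ((A - m * y) * (w - y) - b * y * (1 + y)) / (w * (1 + w))"

locale beta_ratio = beta_weight +
  fixes m :: real
  assumes m_pos: "m > 0"
begin

abbreviation k :: real where "k \<equiv> A + m + 1"

definition ratio :: "real \<Rightarrow> real" where
  "ratio w = w * mom 1 k w / mom 0 k w"

lemma k_pos: "k > 0" using A_pos m_pos by simp

lemma borel_measurable_ratio [measurable]: "ratio \<in> borel_measurable borel"
  unfolding ratio_def[abs_def] by measurable

lemma ratio_pos: "w > 0 \<Longrightarrow> ratio w > 0"
  using mom_pos[of w k] k_pos by (simp add: ratio_def)

lemma ratio_less: "w > 0 \<Longrightarrow> ratio w < w"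
  using mom_pos[of w k] mom_Suc_less[of w k 0] k_pos by (simp add: ratio_def divide_less_eq)

lemma ratio_upper:
  assumes w: "w > 0"
  shows "ratio w * (A + (b + 1) + min m (b + 1) * w) \<le> A * w"
proof -
  define J0 J1 J2 where "J0 = mom 0 k w" "J1 = mom 1 k w" "J2 = mom 2 k w"
  note defs = this
  have J: "0 < J0" "0 < J2" "J2 < J1"
    using w k_pos mom_pos[of w k] mom_Suc_less[of w k 1] by (auto simp: defs numeral_2_eq_2)
  have "mom 0 (A + m) w = J0 + w * J1" "mom 1 (A + m) w = J1 + w * J2"
    using mom_shift[of w "A + m" 0] mom_shift[of w "A + m" 1] w A_pos m_pos
    by (simp_all add: defs numeral_2_eq_2)
  with mom_by_parts[OF w, of "A + m"] A_pos m_pos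
  have identity: "A * J0 = (A + (b + 1) + m * w) * J1 - (m - (b + 1)) * w * J2"
    by (simp add: defs algebra_simps)
  have "(m - (b + 1)) * J2 \<le> (m - min m (b + 1)) * J1"
  proof (cases "m \<le> b + 1")
    case True
    then show ?thesis using J by (simp add: mult_nonpos_nonneg)
  next
    case False
    then show ?thesis using J by (simp add: mult_left_mono)
  qed
  then have "w * ((m - (b + 1)) * J2) \<le> w * ((m - min m (b + 1)) * J1)"
    using w by (intro mult_left_mono) auto
  with identity have "(A + (b + 1) + min m (b + 1) * w) * J1 \<le> A * J0"
    by (simp add: algebra_simps)
  then have "w * ((A + (b + 1) + min m (b + 1) * w) * J1) \<le> w * (A * J0)"
    using w by (intro mult_left_mono) auto
  then show ?thesis
    using J unfolding ratio_def defs[symmetric] by (simp add: divide_le_eq mult_ac)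
qed

lemma has_real_derivative_ratio:
  assumes w: "w > 0"
  shows "(ratio has_real_derivative riccati A b m w (ratio w)) (at w)"
proof -
  define J0 J1 K1 K2 where "J0 = mom 0 k w" "J1 = mom 1 k w" "K1 = mom 1 (k + 1) w" "K2 = mom 2 (k + 1) w"
  note defs = this
  have J0: "J0 > 0" using w k_pos by (simp add: defs mom_pos)
  have J1: "J1 = K1 + w * K2"
    using mom_shift[of w k 1] w k_pos by (simp add: defs numeral_2_eq_2)
  have "A * J0 - (A + b + 1) * J1 = k * w * (K1 - K2)"
    using mom_by_parts[OF w, of k] k_pos by (simp add: defs)
  then have K1: "k * ((1 + w) * K1) = A * J0 + (m - b) * J1"
    unfolding J1 by (simp add: algebra_simps)
  have "(ratio has_real_derivative ((J1 - k * w * K2) * J0 + k * w * K1 * J1) / (J0 * J0)) (at w)"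
    unfolding ratio_def[abs_def]
    using has_real_derivative_mom[OF w, of k 1] has_real_derivative_mom[OF w, of k 0] k_pos J0
    by (auto intro!: derivative_eq_intros simp: defs numeral_2_eq_2 algebra_simps)
  moreover have "((J1 - k * w * K2) * J0 + k * w * K1 * J1) / (J0 * J0) = riccati A b m w (ratio w)"
    (is "?N / _ = _")
  proof -
    define y where "y = ratio w"
    have y: "w * J1 = y * J0" using J0 by (simp add: y_def ratio_def defs)
    have "w * (1 + w) * ?N = w * ((1 + w) * (1 - k) * J1 * J0 + k * ((1 + w) * K1) * (J0 + w * J1))"
      unfolding J1 by (simp add: algebra_simps)
    also have "\<dots> = (A * J0 - m * (w * J1)) * (w * J0 - w * J1) - b * (w * J1) * (J0 + w * J1)"
      unfolding K1 by (simp add: algebra_simps)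
    also have "\<dots> = ((A - m * y) * (w - y) - b * y * (1 + y)) * (J0 * J0)"
      unfolding y by (simp add: algebra_simps)
    finally have "?N = riccati A b m w y * (J0 * J0)"
      using w by (simp add: riccati_def eq_divide_eq mult_ac)
    then show ?thesis using J0 by (simp add: y_def)
  qed
  ultimately show ?thesis by simp
qed

lemma phi_eq_ratio:
  assumes "A = p/2 + a + 1" "m = n/2 + e - a" and "w > 0"
  shows "phi p n a b e w = ratio w"
proof -
  have exponent: "- p/2 - n/2 - e - 2 = - k" using assms by simp
  let ?kernel = "\<lambda>l. (1 + w * l) powr (- k)"
  have "mom 0 k w = (LBINT l=0..1. l powr (p/2 + a) * (1 - l) powr b * ?kernel l)"
    unfolding mom_def using assms(1) by (subst integral_beta_measure) (simp_all add: mult.assoc)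
  moreover have "mom 1 k w = (LBINT l=0..1. l powr (p/2 + a + 1) * (1 - l) powr b * ?kernel l)"
  proof -
    have "mom 1 k w = (LBINT l=0..1. l powr (A - 1) * (1 - l) powr b * (l ^ 1 * ?kernel l))"
      unfolding mom_def by (rule integral_beta_measure) measurable
    also have "\<dots> = (LBINT l=0..1. l powr (p/2 + a + 1) * (1 - l) powr b * ?kernel l)"
    proof (rule interval_integral_cong)
      fix l assume "l \<in> einterval (min 0 1) (max 0 1)"
      then have "l > 0" by (auto simp: einterval_def zero_ereal_def)
      then have "l powr (p/2 + a + 1) = l powr (A - 1) * l"
        using powr_add[of l "A - 1" 1] assms(1) by simp
      then show "l powr (A - 1) * (1 - l) powr b * (l ^ 1 * ?kernel l) =
          l powr (p/2 + a + 1) * (1 - l) powr b * ?kernel l" by simp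
    qed
    finally show ?thesis .
  qed
  ultimately show ?thesis unfolding phi_def ratio_def exponent by simp
qed

end

section \<open>Comparison for the Riccati equation\<close>

lemma last_zero_before_negative:
  fixes g :: "real \<Rightarrow> real"
  assumes "r \<le> s" and cont: "continuous_on {r..s} g" and "g r \<ge> 0" and "g s < 0"
  obtains v where "r \<le> v" "v < s" "g v = 0" "\<And>u. v < u \<Longrightarrow> u \<le> s \<Longrightarrow> g u < 0"
proof -
  define T where "T = {u \<in> {r..s}. 0 \<le> g u}"
  have "closed T"
    unfolding T_def by (rule continuous_on_closed_Collect_le) (auto intro: cont)
  then have "compact T"
    by (auto simp: compact_eq_bounded_closed T_def intro: bounded_subset[of "{r..s}"])
  moreover have "T \<noteq> {}" using assms by (auto simp: T_def)
  ultimately obtain v where v: "v \<in> T" and max: "\<And>u. u \<in> T \<Longrightarrow> u \<le> v"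
    by (meson compact_attains_sup)
  then have "r \<le> v" "v < s" "g v \<ge> 0" using assms(4) by (auto simp: T_def less_le)
  moreover have neg: "g u < 0" if "v < u" "u \<le> s" for u
    using that max[of u] \<open>r \<le> v\<close> by (force simp: T_def)
  moreover have "g v = 0"
  proof -
    obtain u where "v \<le> u" "u \<le> s" "g u = 0"
      using IVT2'[of g s 0 v] assms(4) \<open>r \<le> v\<close> \<open>v < s\<close> \<open>g v \<ge> 0\<close> continuous_on_subset[OF cont]
      by fastforce
    with neg[of u] show ?thesis by (cases "u = v") auto
  qed
  ultimately show ?thesis using that by blast
qed

lemma nonneg_if_increasing_at_zeros:
  fixes g g' :: "real \<Rightarrow> real"
  assumes "r \<le> s"
    and deriv: "\<And>u. r \<le> u \<Longrightarrow> u \<le> s \<Longrightarrow> (g has_real_derivative g' u) (at u)"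
    and start: "g r \<ge> 0"
    and increasing: "\<And>u. r \<le> u \<Longrightarrow> u \<le> s \<Longrightarrow> g u = 0 \<Longrightarrow> g' u > 0"
  shows "g s \<ge> 0"
proof (rule ccontr)
  assume "\<not> g s \<ge> 0"
  moreover have "continuous_on {r..s} g"
    using deriv by (meson DERIV_isCont atLeastAtMost_iff continuous_at_imp_continuous_on)
  ultimately obtain v where v: "r \<le> v" "v < s" "g v = 0" and after: "\<And>u. v < u \<Longrightarrow> u \<le> s \<Longrightarrow> g u < 0"
    using last_zero_before_negative[of r s g] assms(1) start by auto
  obtain d where d: "d > 0" "\<And>h. h > 0 \<Longrightarrow> h < d \<Longrightarrow> g v < g (v + h)"
    using DERIV_pos_inc_right[OF deriv increasing] v by (metis less_imp_le)
  define h where "h = min (d / 2) (s - v)"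
  have "h > 0" "h < d" "v + h \<le> s" using d(1) v by (auto simp: h_def)
  with d(2)[of h] after[of "v + h"] v show False by auto
qed

lemma nonneg_if_nondecreasing_when_negative:
  fixes g g' :: "real \<Rightarrow> real"
  assumes "r \<le> s"
    and deriv: "\<And>u. r \<le> u \<Longrightarrow> u \<le> s \<Longrightarrow> (g has_real_derivative g' u) (at u)"
    and start: "g r \<ge> 0"
    and nondecreasing: "\<And>u. r \<le> u \<Longrightarrow> u \<le> s \<Longrightarrow> g u < 0 \<Longrightarrow> g' u \<ge> 0"
  shows "g s \<ge> 0"
proof (rule ccontr)
  assume neg: "\<not> g s \<ge> 0"
  moreover have "continuous_on {r..s} g"
    using deriv by (meson DERIV_isCont atLeastAtMost_iff continuous_at_imp_continuous_on)
  ultimately obtain v where v: "r \<le> v" "v < s" "g v = 0" and after: "\<And>u. v < u \<Longrightarrow> u \<le> s \<Longrightarrow> g u < 0"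
    using last_zero_before_negative[of r s g] assms(1) start by auto
  then obtain z where z: "v < z" "z < s" "g s - g v = (s - v) * g' z"
    using MVT2[of v s g g'] deriv by auto
  then have "g' z \<ge> 0" using nondecreasing[of z] after[of z] v by auto
  with z v have "g s \<ge> 0" by simp
  with neg show False by simp
qed

locale riccati_solution =
  fixes A b m :: real and \<phi> :: "real \<Rightarrow> real"
  assumes A_pos: "A > 0" and b_gt: "b > -1" and m_pos: "m > 0"
    and pos: "w > 0 \<Longrightarrow> \<phi> w > 0"
    and less: "w > 0 \<Longrightarrow> \<phi> w < w"
    and upper: "w > 0 \<Longrightarrow> \<phi> w * (A + (b + 1) + min m (b + 1) * w) \<le> A * w"
    and deriv: "w > 0 \<Longrightarrow> (\<phi> has_real_derivative riccati A b m w (\<phi> w)) (at w)"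
begin

abbreviation \<phi>' :: "real \<Rightarrow> real" where "\<phi>' w \<equiv> riccati A b m w (\<phi> w)"

lemma riccati_eq: "w > 0 \<Longrightarrow> w * (1 + w) * \<phi>' w = (A - m * \<phi> w) * (w - \<phi> w) - b * \<phi> w * (1 + \<phi> w)"
  by (simp add: riccati_def)

lemma min_mult_\<phi>_le:
  assumes w: "w > 0"
  shows "min m (b + 1) * \<phi> w \<le> A"
proof -
  have "0 \<le> \<phi> w * (A + (b + 1))" using pos[OF w] A_pos b_gt by simp
  then have "w * (min m (b + 1) * \<phi> w) \<le> w * A"
    using upper[OF w] by (simp add: algebra_simps)
  then show ?thesis using w by simp
qed

definition \<phi>_bound :: real where "\<phi>_bound = A / min m (b + 1)"

lemma \<phi>_le_bound: "w > 0 \<Longrightarrow> \<phi> w \<le> \<phi>_bound"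
  using min_mult_\<phi>_le[of w] m_pos b_gt by (simp add: \<phi>_bound_def le_divide_eq mult.commute)

lemma abs_\<phi>'_le:
  assumes w: "w > 0"
  shows "\<bar>\<phi>' w\<bar> \<le> A + m * \<phi>_bound + \<bar>b\<bar>"
proof -
  note bounds = pos[OF w] less[OF w] \<phi>_le_bound[OF w]
  have denominator_pos: "w * (1 + w) > 0" using w by simp
  have "m * \<phi> w \<le> m * \<phi>_bound" using bounds m_pos by simp
  then have "\<bar>A - m * \<phi> w\<bar> \<le> A + m * \<phi>_bound" using mult_pos_pos[OF m_pos bounds(1)] A_pos by linarith
  moreover have "\<bar>w - \<phi> w\<bar> \<le> w * (1 + w)" using bounds w by (simp add: algebra_simps)
  ultimately have "\<bar>(A - m * \<phi> w) * (w - \<phi> w)\<bar> \<le> (A + m * \<phi>_bound) * (w * (1 + w))"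
    unfolding abs_mult by (intro mult_mono) auto
  moreover have "\<bar>b * \<phi> w * (1 + \<phi> w)\<bar> \<le> \<bar>b\<bar> * (w * (1 + w))"
    unfolding abs_mult mult.assoc using bounds w by (intro mult_mono) auto
  ultimately have "\<bar>w * (1 + w) * \<phi>' w\<bar> \<le> (A + m * \<phi>_bound + \<bar>b\<bar>) * (w * (1 + w))"
    unfolding riccati_eq[OF w] distrib_right[of _ "\<bar>b\<bar>"] by linarith
  also have "\<bar>w * (1 + w) * \<phi>' w\<bar> = \<bar>\<phi>' w\<bar> * (w * (1 + w))"
    using w by (simp add: abs_mult)
  finally show ?thesis using denominator_pos by (rule mult_right_le_imp_le)
qed

lemma \<phi>_le_limit_if_b_nonneg:
  assumes w: "w > 0" and b_nonneg: "b \<ge> 0"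
  shows "m * \<phi> w \<le> A"
proof -
  define r where "r = min w (A / m)"
  have r: "r > 0" "r \<le> w" "m * r \<le> A" using w A_pos m_pos by (auto simp: r_def min_def field_simps)
  have "A - m * \<phi> w \<ge> 0"
  proof (rule nonneg_if_nondecreasing_when_negative[where g = "\<lambda>u. A - m * \<phi> u"
        and g' = "\<lambda>u. - m * \<phi>' u", OF r(2)])
    fix u assume "r \<le> u" "u \<le> w"
    then have u: "u > 0" using r by simp
    show "((\<lambda>u. A - m * \<phi> u) has_real_derivative - m * \<phi>' u) (at u)"
      by (auto intro!: derivative_eq_intros deriv[OF u])
    assume "A - m * \<phi> u < 0"
    then have "(A - m * \<phi> u) * (u - \<phi> u) \<le> 0"
      using less[OF u] by (simp add: mult_nonpos_nonneg)
    moreover have "b * \<phi> u * (1 + \<phi> u) \<ge> 0" using b_nonneg pos[OF u] by simp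
    ultimately have "\<phi>' u \<le> 0"
      unfolding riccati_def using u by (intro divide_nonpos_pos) auto
    then show "- m * \<phi>' u \<ge> 0" using m_pos by (simp add: mult_le_0_iff)
  next
    have "m * \<phi> r \<le> m * r" using less[OF r(1)] m_pos by simp
    with r(3) show "A - m * \<phi> r \<ge> 0" by simp
  qed
  then show ?thesis by simp
qed

lemma \<phi>_le_limit:
  assumes w: "w > 0" and "b \<ge> min (m - 1) 0"
  shows "m * \<phi> w \<le> A"
  using assms \<phi>_le_limit_if_b_nonneg[OF w] min_mult_\<phi>_le[OF w]
  by (cases "b \<ge> 0") (auto simp: min_def split: if_splits)

definition numerator :: "real \<Rightarrow> real" where
  "numerator w = (A - m * \<phi> w) * (w - \<phi> w) - b * \<phi> w * (1 + \<phi> w)"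

lemma \<phi>'_nonneg_iff: "w > 0 \<Longrightarrow> \<phi>' w \<ge> 0 \<longleftrightarrow> numerator w \<ge> 0"
  by (simp add: riccati_def numerator_def pos_le_divide_eq)

lemma numerator_stays_nonneg:
  assumes b_pos: "b > 0" and "0 < r" "r \<le> s" "numerator r \<ge> 0"
  shows "numerator s \<ge> 0"
proof (rule nonneg_if_increasing_at_zeros[where g = numerator, OF assms(3) _ assms(4)])
  fix u assume "r \<le> u"
  then have u: "u > 0" using assms(2) by simp
  show "(numerator has_real_derivative - m * \<phi>' u * (u - \<phi> u) + (A - m * \<phi> u) * (1 - \<phi>' u)
      - b * \<phi>' u * (1 + 2 * \<phi> u)) (at u)"
    unfolding numerator_def[abs_def]
    by (auto intro!: derivative_eq_intros deriv[OF u] simp: algebra_simps)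
  assume zero: "numerator u = 0"
  then have "\<phi>' u = 0" by (simp add: riccati_def numerator_def)
  moreover have "(A - m * \<phi> u) * (u - \<phi> u) > 0"
    using zero b_pos pos[OF u] by (simp add: numerator_def)
  then have "A - m * \<phi> u > 0" using less[OF u] by (simp add: zero_less_mult_iff)
  ultimately show "- m * \<phi>' u * (u - \<phi> u) + (A - m * \<phi> u) * (1 - \<phi>' u) - b * \<phi>' u * (1 + 2 * \<phi> u) > 0"
    by simp
qed

lemma \<phi>'_nonneg_if_b_pos:
  assumes w: "w > 0" and b_pos: "b > 0"
  shows "\<phi>' w \<ge> 0"
proof (rule ccontr)
  assume "\<not> \<phi>' w \<ge> 0"
  then have neg: "numerator w < 0" using \<phi>'_nonneg_iff[OF w] by simp
  define r where "r = min w (\<phi> w)"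
  have r: "0 < r" "r \<le> w" "r \<le> \<phi> w" using w pos[OF w] by (auto simp: r_def)
  have "\<phi> w \<le> \<phi> r"
  proof (rule DERIV_nonpos_imp_nonincreasing[OF r(2)])
    fix u assume "r \<le> u" "u \<le> w"
    then have u: "u > 0" using r by simp
    have "\<phi>' u \<le> 0"
      using numerator_stays_nonneg[OF b_pos u \<open>u \<le> w\<close>] neg \<phi>'_nonneg_iff[OF u] by linarith
    with deriv[OF u] show "\<exists>y. (\<phi> has_real_derivative y) (at u) \<and> y \<le> 0" by blast
  qed
  with r less[OF r(1)] show False by simp
qed

lemma \<phi>'_nonneg:
  assumes w: "w > 0" and b_ge: "b \<ge> min (m - 1) 0"
  shows "\<phi>' w \<ge> 0"
proof (cases "b > 0")
  case True
  then show ?thesis by (rule \<phi>'_nonneg_if_b_pos[OF w])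
next
  case False
  then have "b * \<phi> w * (1 + \<phi> w) \<le> 0" using pos[OF w] by (simp add: mult_nonpos_nonneg)
  moreover have "(A - m * \<phi> w) * (w - \<phi> w) \<ge> 0" using \<phi>_le_limit[OF w b_ge] less[OF w] by simp
  ultimately show ?thesis unfolding riccati_def using w by (intro divide_nonneg_pos) auto
qed

lemma risk_inequality:
  assumes w: "w > 0" and b_ge: "b \<ge> min (m - 1) 0" and "A \<le> c * m" and "\<nu> \<ge> 0"
  shows "\<nu> * (c - \<phi> w) * \<phi> w + 4 * (1 + \<phi> w) * (w * \<phi>' w) \<ge> 0"
proof -
  have "m * \<phi> w \<le> m * c" using \<phi>_le_limit[OF w b_ge] assms(3) by (simp add: mult.commute)
  then have "\<phi> w \<le> c" using m_pos by simp
  then show ?thesis using \<phi>'_nonneg[OF w b_ge] pos[OF w] w \<open>\<nu> \<ge> 0\<close> by simp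
qed

end

text \<open>
  Bounding \<open>\<phi>\<close> from above means bounding \<open>\<zeta> = A / \<phi>\<close> from below, and \<open>\<zeta>\<close> again satisfies a Riccati
  equation. The comparison function \<open>m + b * curve\<close> comes from solving the desired bound on
  \<open>w * \<phi>' w / \<phi> w\<close> for \<open>\<zeta>\<close>, with \<open>\<phi>\<close> replaced by its limit \<open>\<alpha>\<close>.
\<close>

locale riccati_negative = riccati_solution +
  assumes b_neg: "b < 0" and b_less: "b + 1 < m"
begin

definition \<zeta> :: "real \<Rightarrow> real" where "\<zeta> w = A / \<phi> w"

definition \<zeta>' :: "real \<Rightarrow> real" where
  "\<zeta>' w = (b * (\<zeta> w + A) - (\<zeta> w - m) * (\<zeta> w * w - A)) / (w * (1 + w))"

lemma \<zeta>_mult_\<phi>: "w > 0 \<Longrightarrow> \<zeta> w * \<phi> w = A"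
  using pos[of w] by (simp add: \<zeta>_def)

lemma has_real_derivative_\<zeta>:
  assumes w: "w > 0"
  shows "(\<zeta> has_real_derivative \<zeta>' w) (at w)"
proof -
  note \<phi> = pos[OF w] and \<zeta>\<phi> = \<zeta>_mult_\<phi>[OF w]
  have "(b * (\<zeta> w + A) - (\<zeta> w - m) * (\<zeta> w * w - A)) * (\<phi> w)\<^sup>2 =
      b * ((\<zeta> w * \<phi> w) * \<phi> w + A * (\<phi> w)\<^sup>2) - (\<zeta> w * \<phi> w - m * \<phi> w) * ((\<zeta> w * \<phi> w) * w - A * \<phi> w)"
    by (simp add: algebra_simps power2_eq_square)
  also have "\<dots> = - A * (w * (1 + w) * \<phi>' w)"
    unfolding \<zeta>\<phi> riccati_eq[OF w] by (simp add: algebra_simps power2_eq_square)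
  finally have "\<zeta>' w * (\<phi> w)\<^sup>2 = - A * \<phi>' w"
    using w by (simp add: \<zeta>'_def divide_eq_eq)
  then have "\<zeta>' w = - A * \<phi>' w / (\<phi> w)\<^sup>2"
    using \<phi> by (simp add: field_simps)
  then show ?thesis
    unfolding \<zeta>_def[abs_def] using \<phi>
    by (auto intro!: derivative_eq_intros deriv[OF w] simp: power2_eq_square)
qed

lemma \<zeta>_lower:
  assumes w: "w > 0"
  shows "\<zeta> w * w \<ge> A + (b + 1) + (b + 1) * w"
proof -
  have "\<phi> w * (\<zeta> w * w) = A * w" using \<zeta>_mult_\<phi>[OF w] by (simp only: mult_ac)
  then have "\<phi> w * (A + (b + 1) + (b + 1) * w) \<le> \<phi> w * (\<zeta> w * w)"
    using upper[OF w] b_less by (simp only: min_absorb2 less_imp_le)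
  then show ?thesis using pos[OF w] by simp
qed

lemma \<zeta>_ge_const:
  assumes w: "w > 0"
  shows "\<zeta> w \<ge> m + b * (A + m)"
proof -
  define C where "C = m + b * (A + m)"
  define r where "r = min w ((A + (b + 1)) / (\<bar>C\<bar> + 1))"
  have r: "0 < r" "r \<le> w" "r \<le> (A + (b + 1)) / (\<bar>C\<bar> + 1)"
    using w A_pos b_gt by (auto simp: r_def)
  have "(\<bar>C\<bar> + 1) * r \<le> A + (b + 1)"
    using r(3) by (simp add: pos_le_divide_eq mult.commute add_nonneg_pos)
  moreover have "(b + 1) * r > 0" using b_gt r by simp
  ultimately have "(\<bar>C\<bar> + 1) * r \<le> \<zeta> r * r" using \<zeta>_lower[OF r(1)] by linarith
  then have start: "\<zeta> r - C \<ge> 0" using r by simp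
  have "\<zeta> w - C \<ge> 0"
  proof (rule nonneg_if_increasing_at_zeros[where g = "\<lambda>u. \<zeta> u - C" and g' = \<zeta>', OF r(2) _ start])
    fix u assume "r \<le> u"
    then have u: "u > 0" using r by simp
    show "((\<lambda>u. \<zeta> u - C) has_real_derivative \<zeta>' u) (at u)"
      by (auto intro!: derivative_eq_intros has_real_derivative_\<zeta>[OF u])
    assume "\<zeta> u - C = 0"
    then have numerator: "b * (\<zeta> u + A) - (\<zeta> u - m) * (\<zeta> u * u - A) =
        (- b) * (A + m) * (\<zeta> u * u - A - (b + 1))"
      unfolding C_def by algebra
    have "(b + 1) * u > 0" using b_gt u by simp
    then have "\<zeta> u * u - A - (b + 1) > 0" using \<zeta>_lower[OF u] by linarith
    then have "(- b) * (A + m) * (\<zeta> u * u - A - (b + 1)) > 0"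
      using b_neg A_pos m_pos by (intro mult_pos_pos) auto
    then show "\<zeta>' u > 0" unfolding \<zeta>'_def numerator using u by (intro divide_pos_pos) auto
  qed
  then show ?thesis by (simp add: C_def)
qed

lemma \<phi>_fraction_le:
  assumes w: "w > 0"
  shows "(b + 1) * (A + m) * \<phi> w \<le> A * (1 + \<phi> w)"
proof -
  have "(m + b * (A + m)) * \<phi> w \<le> \<zeta> w * \<phi> w"
    using \<zeta>_ge_const[OF w] pos[OF w] by (intro mult_right_mono) auto
  then show ?thesis unfolding \<zeta>_mult_\<phi>[OF w] by (simp add: algebra_simps)
qed

definition \<alpha> :: real where "\<alpha> = A / m"
definition T :: real where "T = (A + 1) / (b + 1)"
definition K :: real where "K = (T + 1) * (1 + \<alpha>)"
definition curve :: "real \<Rightarrow> real" where "curve u = T + K / (u - \<alpha>)"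

lemma \<alpha>_pos: "\<alpha> > 0" and \<alpha>_mult: "m * \<alpha> = A" "A + m = m * (1 + \<alpha>)"
  using A_pos m_pos by (auto simp: \<alpha>_def algebra_simps)

lemma T_pos: "T > 0" and T_eq: "(b + 1) * T = A + 1"
  using A_pos b_gt by (auto simp: T_def)

lemma K_pos: "K > 0"
  using T_pos \<alpha>_pos by (simp add: K_def)

lemma A_mult_K: "A * K = \<alpha> * ((T + 1) * (A + m))"
proof -
  have "\<alpha> * ((T + 1) * (A + m)) = (T + 1) * (\<alpha> * A + m * \<alpha>)" by (simp add: algebra_simps)
  then show ?thesis unfolding \<alpha>_mult(1) K_def by (simp add: algebra_simps)
qed

lemma curve_gt: "u > \<alpha> \<Longrightarrow> curve u > T"
  using K_pos by (simp add: curve_def)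

lemma curve_mult: "u > \<alpha> \<Longrightarrow> curve u * (u - \<alpha>) = T * (1 + u) + (1 + \<alpha>)"
  by (simp add: curve_def K_def field_simps)

lemma curve_slope:
  assumes u: "u > \<alpha>"
  shows "K * u / (u - \<alpha>)\<^sup>2 = \<alpha> * (curve u - T)\<^sup>2 / K + (curve u - T)"
proof -
  define d where "d = u - \<alpha>"
  have d: "d > 0" "u = \<alpha> + d" using u by (auto simp: d_def)
  have curve_d: "curve u - T = K / d" by (simp add: curve_def d_def)
  show ?thesis
    unfolding curve_d d_def[symmetric] using d K_pos by (simp add: field_simps power2_eq_square)
qed

lemma curve_square_term_le:
  assumes y: "T < y" "y \<le> A + m"
  shows "\<alpha> * (y - T)\<^sup>2 / K \<le> (b + 1) * A * (A + m - T)"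
proof -
  define d where "d = A + m - T"
  have d: "0 \<le> d" "y - T \<le> d" "d \<le> A + m" using y T_pos by (auto simp: d_def)
  have "(b + 1) * (T + 1) \<ge> 1" using T_eq A_pos b_gt by (simp add: algebra_simps)
  then have "1 * d \<le> (b + 1) * (T + 1) * (A + m)"
    using d by (intro mult_mono) auto
  then have "\<alpha> * d * d \<le> \<alpha> * ((b + 1) * (T + 1) * (A + m)) * d"
    using \<alpha>_pos d by (intro mult_right_mono mult_left_mono) auto
  also have "\<dots> = (b + 1) * A * d * K"
    using A_mult_K by (simp add: mult_ac)
  finally have "\<alpha> * d\<^sup>2 / K \<le> (b + 1) * A * d"
    using K_pos by (simp add: divide_le_eq power2_eq_square mult_ac)
  moreover have "\<alpha> * (y - T)\<^sup>2 / K \<le> \<alpha> * d\<^sup>2 / K"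
    using y d \<alpha>_pos K_pos by (intro divide_right_mono mult_left_mono power_mono) auto
  ultimately show ?thesis by (simp add: d_def)
qed

lemma curve_product_term_le:
  assumes y: "0 < y" "y \<le> A + m"
  shows "y * (\<alpha> * y + T) / (1 + \<alpha>) \<le> A * (A + m) + m * T"
proof -
  have "y * (\<alpha> * y + T) / (1 + \<alpha>) \<le> (A + m) * (\<alpha> * (A + m) + T) / (1 + \<alpha>)"
    using y \<alpha>_pos T_pos by (intro divide_right_mono mult_mono add_mono) auto
  also have "\<dots> = m * (\<alpha> * (A + m) + T)"
    using \<alpha>_pos by (subst \<alpha>_mult(2)) simp
  also have "\<dots> = (m * \<alpha>) * (A + m) + m * T" by (simp add: algebra_simps)
  finally show ?thesis unfolding \<alpha>_mult(1) .
qed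

lemma curve_quadratic_bound:
  assumes y: "T < y" "y \<le> A + m"
  shows "\<alpha> * (y - T)\<^sup>2 / K + (y - T) - b * (y * (\<alpha> * y + T) / (1 + \<alpha>)) < m * T"
proof -
  have "(- b) * (y * (\<alpha> * y + T) / (1 + \<alpha>)) \<le> (- b) * (A * (A + m) + m * T)"
    using y T_pos b_neg by (intro mult_left_mono curve_product_term_le) auto
  then have "\<alpha> * (y - T)\<^sup>2 / K + (y - T) - b * (y * (\<alpha> * y + T) / (1 + \<alpha>)) \<le>
      (b + 1) * A * (A + m - T) + (A + m - T) + (- b) * (A * (A + m) + m * T)"
    using curve_square_term_le[OF y] y by linarith
  also have "\<dots> = A * (A + m) - (A + m) * ((b + 1) * T) + A + m - T + m * T"
    by (simp add: algebra_simps)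
  also have "\<dots> = m * T - T" unfolding T_eq by (simp add: algebra_simps)
  finally show ?thesis using T_pos by linarith
qed

lemma curve_strict_subsolution:
  assumes u: "u > \<alpha>" and y_le: "curve u \<le> A + m" and z: "z = m + b * curve u"
  shows "curve u * (z * u - A) - (z + A) > K * u * (1 + u) / (u - \<alpha>)\<^sup>2"
proof -
  define y where "y = curve u"
  note yd = curve_mult[OF u, folded y_def]
  have "K * u * (1 + u) / (u - \<alpha>)\<^sup>2 = (1 + u) * (\<alpha> * (y - T)\<^sup>2 / K + (y - T))"
    unfolding y_def curve_slope[OF u, symmetric] by simp
  also have "\<dots> < (1 + u) * (m * T + b * (y * (\<alpha> * y + T) / (1 + \<alpha>)))"
    using curve_quadratic_bound[of y] curve_gt[OF u] y_le u \<alpha>_pos by (simp add: y_def)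
  also have "\<dots> = m * T * (1 + u) + b * y * ((1 + u) * (\<alpha> * y + T) / (1 + \<alpha>))"
    by (simp add: algebra_simps)
  also have "(1 + u) * (\<alpha> * y + T) / (1 + \<alpha>) = y * u - 1"
  proof -
    have "(y * u - 1) * (1 + \<alpha>) = (1 + u) * (\<alpha> * y) + (y * (u - \<alpha>) - (1 + \<alpha>))"
      by (simp add: algebra_simps)
    also have "\<dots> = (1 + u) * (\<alpha> * y + T)" unfolding yd by (simp add: algebra_simps)
    finally show ?thesis using \<alpha>_pos by (simp add: divide_eq_eq)
  qed
  also have "m * T * (1 + u) + b * y * (y * u - 1) =
      m * (y * (u - \<alpha>)) - m * (1 + \<alpha>) + b * y * (y * u - 1)"
    unfolding yd by (simp add: algebra_simps)
  also have "\<dots> = y * (m * u) - (y + 1) * (m * \<alpha>) - m + b * y * (y * u - 1)"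
    by (simp add: algebra_simps)
  also have "\<dots> = y * (z * u - A) - (z + A)"
    unfolding \<alpha>_mult(1) z y_def[symmetric] by (simp add: algebra_simps)
  finally show ?thesis by (simp add: y_def)
qed

lemma \<zeta>'_gt_if_on_curve:
  assumes u: "u > \<alpha>" and "curve u \<le> A + m" and z: "\<zeta> u = m + b * curve u"
  shows "\<zeta>' u + b * (K / (u - \<alpha>)\<^sup>2) > 0"
proof -
  have u_pos: "u > 0" using u \<alpha>_pos by simp
  have "- b * (K * u * (1 + u) / (u - \<alpha>)\<^sup>2) < - b * (curve u * (\<zeta> u * u - A) - (\<zeta> u + A))"
    using curve_strict_subsolution[OF assms] b_neg by (intro mult_strict_left_mono) auto
  also have "\<dots> = b * (\<zeta> u + A) - (\<zeta> u - m) * (\<zeta> u * u - A)"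
    unfolding z by (simp add: algebra_simps)
  also have "\<dots> = \<zeta>' u * (u * (1 + u))"
    using u_pos by (simp add: \<zeta>'_def)
  finally have "(- b * (K / (u - \<alpha>)\<^sup>2)) * (u * (1 + u)) < \<zeta>' u * (u * (1 + u))"
    by (simp add: mult_ac)
  then have "- b * (K / (u - \<alpha>)\<^sup>2) < \<zeta>' u"
    by (rule mult_right_less_imp_less) (use u_pos in simp)
  then show ?thesis by simp
qed

lemma \<zeta>_ge_curve:
  assumes w: "w > \<alpha>"
  shows "\<zeta> w \<ge> m + b * curve w"
proof (cases "curve w \<ge> A + m")
  case True
  then have "b * curve w \<le> b * (A + m)" using b_neg by simp
  with \<zeta>_ge_const[of w] w \<alpha>_pos show ?thesis by simp
next
  case False
  define d where "d = A + m - T"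
  have d: "d > 0" "K / (w - \<alpha>) < d" using False curve_gt[OF w] by (auto simp: d_def curve_def)
  define r where "r = \<alpha> + K / d"
  have r: "r > \<alpha>" "r \<le> w" using d K_pos w by (auto simp: r_def field_simps)
  have curve_r: "curve r = A + m" using d K_pos by (simp add: curve_def r_def d_def)
  have "\<zeta> w - m - b * curve w \<ge> 0"
  proof (rule nonneg_if_increasing_at_zeros[where g = "\<lambda>u. \<zeta> u - m - b * curve u"
        and g' = "\<lambda>u. \<zeta>' u + b * (K / (u - \<alpha>)\<^sup>2)", OF r(2)])
    show "\<zeta> r - m - b * curve r \<ge> 0" using \<zeta>_ge_const[of r] r \<alpha>_pos by (simp add: curve_r)
    fix u assume "r \<le> u"
    then have u: "u > \<alpha>" "u > 0" using r \<alpha>_pos by auto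
    show "((\<lambda>u. \<zeta> u - m - b * curve u) has_real_derivative \<zeta>' u + b * (K / (u - \<alpha>)\<^sup>2)) (at u)"
      unfolding curve_def using u
      by (auto intro!: derivative_eq_intros has_real_derivative_\<zeta> simp: power2_eq_square)
    have "K / (u - \<alpha>) \<le> K / (r - \<alpha>)"
      using \<open>r \<le> u\<close> r u K_pos by (intro divide_left_mono) auto
    then have "curve u \<le> A + m" using curve_r by (simp add: curve_def)
    then show "\<zeta>' u + b * (K / (u - \<alpha>)\<^sup>2) > 0" if "\<zeta> u - m - b * curve u = 0"
      using that u by (intro \<zeta>'_gt_if_on_curve) auto
  qed
  then show ?thesis by simp
qed

lemma \<zeta>_excess_le:
  assumes w: "w > 0"
  shows "(m - \<zeta> w) * (w - \<phi> w) \<le> - b * (T * (1 + w) + (1 + \<phi> w))"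
proof (cases "\<zeta> w \<ge> m")
  case True
  then have "(m - \<zeta> w) * (w - \<phi> w) \<le> 0" using less[OF w] by (simp add: mult_nonpos_nonneg)
  also have "0 \<le> - b * (T * (1 + w) + (1 + \<phi> w))"
    using b_neg T_pos w pos[OF w] by (intro mult_nonneg_nonneg) auto
  finally show ?thesis .
next
  case False
  then have "A < m * \<phi> w" using \<zeta>_mult_\<phi>[OF w] pos[OF w] by (metis mult_strict_right_mono not_le)
  then have \<phi>: "\<alpha> < \<phi> w" using m_pos by (simp add: \<alpha>_def divide_less_eq mult.commute)
  then have w_gt: "\<alpha> < w" using less[OF w] by simp
  have "(m - \<zeta> w) * (w - \<phi> w) \<le> (m - \<zeta> w) * (w - \<alpha>)"
    using False \<phi> by (intro mult_left_mono) auto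
  also have "\<dots> \<le> - b * curve w * (w - \<alpha>)"
    using \<zeta>_ge_curve[OF w_gt] w_gt by (intro mult_right_mono) auto
  also have "\<dots> = - b * (T * (1 + w) + (1 + \<alpha>))"
    by (simp only: mult.assoc curve_mult[OF w_gt])
  also have "\<dots> \<le> - b * (T * (1 + w) + (1 + \<phi> w))"
    using b_neg \<phi> by (intro mult_left_mono) auto
  finally show ?thesis .
qed

lemma \<phi>'_lower:
  assumes w: "w > 0"
  shows "w * \<phi>' w \<ge> b * T * \<phi> w"
proof -
  have "(m * \<phi> w - \<zeta> w * \<phi> w) * (w - \<phi> w) = (m - \<zeta> w) * (w - \<phi> w) * \<phi> w"
    by (simp add: algebra_simps)
  also have "\<dots> \<le> - b * (T * (1 + w) + (1 + \<phi> w)) * \<phi> w"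
    using \<zeta>_excess_le[OF w] pos[OF w] by (intro mult_right_mono) auto
  finally have "b * T * \<phi> w * (1 + w) \<le> w * (1 + w) * \<phi>' w"
    unfolding \<zeta>_mult_\<phi>[OF w] riccati_eq[OF w] by (simp add: algebra_simps)
  then have "b * T * \<phi> w * (1 + w) \<le> w * \<phi>' w * (1 + w)" by (simp only: mult_ac)
  then show ?thesis by (rule mult_right_le_imp_le) (use w in simp)
qed

lemma risk_inequality_negative:
  assumes w: "w > 0" and \<nu>: "\<nu> \<ge> 0" and c: "c \<ge> 0"
    and b_ge: "- b * (\<nu> * c + 4 * (A + 1)) * (1 + A / m) \<le> \<nu> * (c - A / m)"
  shows "\<nu> * (c - \<phi> w) * \<phi> w + 4 * (1 + \<phi> w) * (w * \<phi>' w) \<ge> 0"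
proof -
  define P where "P = (b + 1) * (A + m)"
  have P: "P > 0" using b_gt A_pos m_pos by (simp add: P_def)
  have "m * (- b * (\<nu> * c + 4 * (A + 1)) * (1 + A / m)) \<le> m * (\<nu> * (c - A / m))"
    using b_ge m_pos by (intro mult_left_mono) auto
  then have param: "\<nu> * (c + 1) * A \<le> P * (\<nu> * c) + 4 * (b * (A + 1) * (A + m))"
    using m_pos by (simp add: P_def algebra_simps add_divide_distrib)
  have PT: "P * (b * T) = b * (A + 1) * (A + m)"
    unfolding P_def T_eq[symmetric] by simp
  have "\<nu> * (c + 1) * (P * \<phi> w) \<le> \<nu> * (c + 1) * (A * (1 + \<phi> w))"
    unfolding P_def using \<phi>_fraction_le[OF w] \<nu> c by (intro mult_left_mono) auto
  also have "\<dots> = \<nu> * (c + 1) * A * (1 + \<phi> w)" by simp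
  also have "\<dots> \<le> (P * (\<nu> * c) + 4 * (P * (b * T))) * (1 + \<phi> w)"
    using param pos[OF w] unfolding PT by (intro mult_right_mono) auto
  finally have "0 \<le> P * (\<nu> * (c - \<phi> w) + 4 * (1 + \<phi> w) * (b * T))"
    by (simp add: algebra_simps)
  then have "0 \<le> (\<nu> * (c - \<phi> w) + 4 * (1 + \<phi> w) * (b * T)) * \<phi> w"
    using P pos[OF w] by (simp add: zero_le_mult_iff)
  also have "\<dots> = \<nu> * (c - \<phi> w) * \<phi> w + 4 * (1 + \<phi> w) * (b * T * \<phi> w)"
    by (simp add: algebra_simps)
  also have "\<dots> \<le> \<nu> * (c - \<phi> w) * \<phi> w + 4 * (1 + \<phi> w) * (w * \<phi>' w)"
    using \<phi>'_lower[OF w] pos[OF w] by (intro add_left_mono mult_left_mono) auto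
  finally show ?thesis .
qed

end

section \<open>Minimaxity of the generalized Bayes estimator\<close>

lemma (in riccati_solution) baranchik:
  assumes "\<phi> \<in> borel_measurable borel"
  shows "baranchik \<phi> \<phi>' (1 + A + (1 + m) * \<phi>_bound + \<bar>b\<bar>)"
proof
  have \<phi>_bound: "\<phi>_bound > 0" "m * \<phi>_bound > 0" using A_pos b_gt m_pos by (simp_all add: \<phi>_bound_def)
  fix w :: real assume w: "w > 0"
  show "\<bar>\<phi> w\<bar> \<le> 1 + A + (1 + m) * \<phi>_bound + \<bar>b\<bar>" "\<bar>\<phi>' w\<bar> \<le> 1 + A + (1 + m) * \<phi>_bound + \<bar>b\<bar>"
    using \<phi>_le_bound[OF w] pos[OF w] abs_\<phi>'_le[OF w] \<phi>_bound A_pos by (auto simp: distrib_right)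
  have "1 * w \<le> (1 + A + (1 + m) * \<phi>_bound + \<bar>b\<bar>) * w"
    using w A_pos m_pos \<phi>_bound by (intro mult_right_mono) (auto intro: add_nonneg_nonneg)
  then show "\<bar>\<phi> w\<bar> \<le> (1 + A + (1 + m) * \<phi>_bound + \<bar>b\<bar>) * w" using less[OF w] pos[OF w] by linarith
qed (use assms deriv in \<open>simp_all add: riccati_def\<close>)

sublocale beta_ratio \<subseteq> riccati_solution A b m ratio
  by unfold_locales (fact A_pos b_gt m_pos ratio_pos ratio_less ratio_upper has_real_derivative_ratio)+

lemma (in beta_ratio) minimax_delta:
  assumes dims: "p = real CARD('p)" "n = real CARD('n)" and c: "c = 2 * (p - 2) / (n + 2)"
    and params: "A = p/2 + a + 1" "m = n/2 + e - a"
    and nonneg: "\<And>w. w > 0 \<Longrightarrow>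
      (n + 2) * (c - ratio w) * ratio w + 4 * (1 + ratio w) * (w * riccati A b m w (ratio w)) \<ge> 0"
  shows "minimax (delta a b e :: (real^'p) \<times> (real^'n) \<Rightarrow> real^'p)"
proof -
  interpret baranchik ratio "\<lambda>w. riccati A b m w (ratio w)" "1 + A + (1 + m) * \<phi>_bound + \<bar>b\<bar>"
    by (rule baranchik) measurable
  have "delta a b e = (estimator :: (real^'p) \<times> (real^'n) \<Rightarrow> real^'p)"
  proof
    fix y :: "(real^'p) \<times> (real^'n)"
    show "delta a b e y = estimator y"
    proof (cases "fst y = 0 \<or> snd y = 0")
      case True
      then show ?thesis by (auto simp: delta_def estimator_def Let_def)
    next
      case False
      then have "W y > 0" by simp
      then show ?thesis by (simp add: delta_def estimator_def Let_def phi_eq_ratio[OF params] flip: dims)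
    qed
  qed
  moreover have "minimax (estimator :: (real^'p) \<times> (real^'n) \<Rightarrow> real^'p)"
    using nonneg unfolding c dims by (intro minimax_estimator) (simp only: improvement_def)
  ultimately show ?thesis by simp
qed

lemma
  fixes a c e n p :: real
  assumes "c > 0" "- p/2 - 1 < a" "a \<le> (c * (n/2 + e) - p/2 - 1) / (1 + c)"
  shows parameter_le_critical: "p/2 + a + 1 \<le> c * (n/2 + e - a)" and parameter_pos: "n/2 + e - a > 0"
proof -
  show critical: "p/2 + a + 1 \<le> c * (n/2 + e - a)"
    using assms by (simp add: pos_le_divide_eq algebra_simps)
  have "0 < c * (n/2 + e - a)" using critical assms(2) by linarith
  then show "n/2 + e - a > 0" using assms(1) by (simp add: zero_less_mult_iff)
qed

lemma parameter_lower_bound: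
  fixes a b c n p \<alpha> :: real
  assumes "- (n + 2) * (c - \<alpha>) / (4 * (p + a + 1) * (\<alpha> + 1)) \<le> b"
    and c: "(n + 2) * c = 2 * (p - 2)" and pos: "p + a + 1 > 0" "\<alpha> > 0"
  shows "- b * ((n + 2) * c + 4 * (p/2 + a + 1 + 1)) * (1 + \<alpha>) \<le> (n + 2) * (c - \<alpha>)"
proof -
  have weight: "(n + 2) * c + 4 * (p/2 + a + 1 + 1) = 4 * (p + a + 1)" by (simp add: c)
  have "- (n + 2) * (c - \<alpha>) \<le> b * (4 * (p + a + 1) * (\<alpha> + 1))"
    using assms(1) pos by (subst (asm) pos_divide_le_eq) auto
  then show ?thesis unfolding weight by (simp add: algebra_simps)
qed

theorem theorem3p7:
  fixes a b e :: real
  defines "p \<equiv> real CARD('p)" and "n \<equiv> real CARD('n)"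
  defines "c \<equiv> 2 * (p - 2) / (n + 2)"
  defines "\<alpha> \<equiv> (p/2 + a + 1) / (n/2 + e - a)"
  assumes "CARD('p) \<ge> 3"
    and "e > - p/2 - n/2 - 1"
  shows "(- p/2 - 1 < a \<and> a \<le> (c * (n/2 + e) - p/2 - 1) / (1 + c) \<and> b \<ge> min (n/2 + e - a - 1) 0
            \<longrightarrow> minimax (delta a b e :: (real^'p) \<times> (real^'n) \<Rightarrow> real^'p))
       \<and> (- p/2 - 1 < a \<and> a < (c * (n/2 + e) - p/2 - 1) / (1 + c) \<and>
            -1 < - (n + 2) * (c - \<alpha>) / (4 * (p + a + 1) * (\<alpha> + 1)) \<and>
            - (n + 2) * (c - \<alpha>) / (4 * (p + a + 1) * (\<alpha> + 1)) \<le> b \<and>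
            b < min 0 (n/2 + e - a - 1)
            \<longrightarrow> minimax (delta a b e :: (real^'p) \<times> (real^'n) \<Rightarrow> real^'p))"
proof -
  define A m where "A = p/2 + a + 1" and "m = n/2 + e - a"
  have dims: "p = real CARD('p)" "n = real CARD('n)" "c = 2 * (p - 2) / (n + 2)"
    by (simp_all add: p_def n_def c_def)
  have c: "c > 0" "(n + 2) * c = 2 * (p - 2)" and n: "n + 2 \<ge> 0" and p: "p > 0"
    using assms(5) by (auto simp: c_def p_def n_def add_pos_nonneg)
  show ?thesis
  proof (intro conjI impI; elim conjE)
    assume a: "- p/2 - 1 < a" "a \<le> (c * (n/2 + e) - p/2 - 1) / (1 + c)"
      and b: "min (n/2 + e - a - 1) 0 \<le> b"
    note critical = parameter_le_critical[OF c(1) a, folded A_def m_def]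
      parameter_pos[OF c(1) a, folded m_def]
    interpret beta_ratio A b m using a b critical by unfold_locales (auto simp: A_def m_def)
    show "minimax (delta a b e :: (real^'p) \<times> (real^'n) \<Rightarrow> real^'p)"
      using critical b n by (intro minimax_delta[OF dims A_def m_def] risk_inequality) (auto simp: m_def)
  next
    assume a: "- p/2 - 1 < a" "a < (c * (n/2 + e) - p/2 - 1) / (1 + c)"
      and b: "-1 < - (n + 2) * (c - \<alpha>) / (4 * (p + a + 1) * (\<alpha> + 1))"
        "- (n + 2) * (c - \<alpha>) / (4 * (p + a + 1) * (\<alpha> + 1)) \<le> b" "b < min 0 (n/2 + e - a - 1)"
    have m: "m > 0" using parameter_pos[OF c(1) a(1) less_imp_le[OF a(2)]] by (simp add: m_def)
    have A: "A > 0" using a by (simp add: A_def)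
    have \<alpha>: "\<alpha> = A / m" "\<alpha> > 0" using A m by (simp_all add: \<alpha>_def A_def m_def)
    interpret beta_ratio A b m using A m b by unfold_locales auto
    interpret riccati_negative A b m ratio using b by unfold_locales (auto simp: m_def)
    show "minimax (delta a b e :: (real^'p) \<times> (real^'n) \<Rightarrow> real^'p)"
      using parameter_lower_bound[OF b(2) c(2) _ \<alpha>(2), folded A_def] \<alpha>(1) a(1) p c(1) n
      by (intro minimax_delta[OF dims A_def m_def] risk_inequality_negative) auto
  qed
qed

end
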